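(* Let $n,m\ge 1$ be integers, let $f_p:\mathbb{R}^n\times\mathbb{R}\to\mathbb{R}^n$ and $f_c:\mathbb{R}^m\times\mathbb{R}\to\mathbb{R}^m$ be continuous, let $G_p\in\mathbb{R}^{1\times n}$, and let $k_1,k_2\in\mathbb{R}$ with $k_1<k_2$. Let $$S=\{(e,u)\in\mathbb{R}^2\mid (u-k_1e)(u-k_2e)\le 0\},\qquad \mathcal{S}=\{\xi=(x,z)\in\mathbb{R}^{n+m}\mid (G_px,z_1)\in S\},$$ $$\mathcal{E}=\{0\}\times\mathbb{R}^m\subseteq\mathbb{R}^{n+m},\qquad f(\xi)=(f_p(x,z_1),f_c(z,G_px))\ \text{ for } \xi=(x,z).$$ Assume that there is $M>0$ such that $\|f(\xi)\|\le M(1+\|\xi\|)$ for all $\xi\in\mathcal{S}$. Then for each initial state $\xi_0\in\mathcal{S}$ there exists a Carathéodory solution $\xi:[0,\infty)\to\mathbb{R}^{n+m}$ on $[0,\infty)$ with $\xi(0)=\xi_0$ to $$\dot\xi=\Pi_{\mathcal{S},\mathcal{E}}(\xi,f(\xi)).$$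
   Context: Here $z_1$ is the first component of $z\in\mathbb{R}^m$. Tangent cone: for a set $C\subseteq\mathbb{R}^N$ and $x\in C$, $T_C(x)$ is the set of all $v\in\mathbb{R}^N$ for which there exist sequences $\{x_i\}_{i\in\mathbb{N}}\subseteq C$ and $\{\tau_i\}_{i\in\mathbb{N}}$ with $\tau_i>0$, $x_i\to x$, $\tau_i\downarrow 0$, and $v=\lim_{i\to\infty}(x_i-x)/\tau_i$. Projection operator: for $\xi\in\mathcal{S}$ and $v\in\mathbb{R}^{n+m}$, $\Pi_{\mathcal{S},\mathcal{E}}(\xi,v)=\operatorname{argmin}_{w\in T_{\mathcal{S}}(\xi),\ w-v\in\mathcal{E}}\|w-v\|$ (Euclidean norm); in this setting the minimizer exists and is unique, and $\Pi_{\mathcal{S},\mathcal{E}}(\xi,v)$ denotes it. Carathéodory solution on $[0,T]$: a function $\xi:[0,T]\to\mathbb{R}^{n+m}$ that is absolutely continuous, satisfies $\dot\xi(t)=\Pi_{\mathcal{S},\mathcal{E}}(\xi(t),f(\xi(t)))$ for almost all $t\in[0,T]$, and satisfies $\xi(t)\in\mathcal{S}$ for all $t\in[0,T]$. A function $\xi:[0,\infty)\to\mathbb{R}^{n+m}$ is a solution on $[0,\infty)$ if its restriction to $[0,T]$ is a solution on $[0,T]$ for each $T>0$. *)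

theory Defs
  imports "HOL-Analysis.Analysis"
begin

definition tangent_cone :: "'a::real_normed_vector set \<Rightarrow> 'a \<Rightarrow> 'a set" where
  "tangent_cone C x =
    {v. \<exists>(y :: nat \<Rightarrow> 'a) (\<tau> :: nat \<Rightarrow> real).
          (\<forall>i. y i \<in> C) \<and> (\<forall>i. \<tau> i > 0) \<and> y \<longlonglongrightarrow> x \<and> decseq \<tau> \<and> \<tau> \<longlonglongrightarrow> 0 \<and>
          (\<lambda>i. (y i - x) /\<^sub>R \<tau> i) \<longlonglongrightarrow> v}"

text \<open>\<^const>\<open>arg_min\<close> picks some minimizer. For the sector constraint sets below, the minimizer
  exists and is unique at every point of the constraint set, so no choice is involved there.\<close>

definition proj_op ::
  "'a::real_normed_vector set \<Rightarrow> 'a set \<Rightarrow> 'a \<Rightarrow> 'a \<Rightarrow> 'a" where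
  "proj_op S E \<xi> v = arg_min (\<lambda>w. norm (w - v)) (\<lambda>w. w \<in> tangent_cone S \<xi> \<and> w - v \<in> E)"

definition abs_continuous_on_Icc ::
  "real \<Rightarrow> real \<Rightarrow> (real \<Rightarrow> 'a::real_normed_vector) \<Rightarrow> bool" where
  "abs_continuous_on_Icc A B g \<longleftrightarrow>
    (\<forall>\<epsilon>>0. \<exists>\<delta>>0. \<forall>(N::nat) (a :: nat \<Rightarrow> real) (b :: nat \<Rightarrow> real).
       (\<forall>i<N. A \<le> a i \<and> a i \<le> b i \<and> b i \<le> B) \<and>
       disjoint_family_on (\<lambda>i. {a i<..<b i}) {..<N} \<and>
       (\<Sum>i<N. b i - a i) < \<delta> \<longrightarrow>
       (\<Sum>i<N. norm (g (b i) - g (a i))) < \<epsilon>)"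

definition caratheodory_solution_on ::
  "'a::real_normed_vector set \<Rightarrow> 'a set \<Rightarrow> ('a \<Rightarrow> 'a) \<Rightarrow> real \<Rightarrow> (real \<Rightarrow> 'a) \<Rightarrow> bool" where
  "caratheodory_solution_on S E f T \<xi> \<longleftrightarrow>
    abs_continuous_on_Icc 0 T \<xi> \<and>
    (AE t\<in>{0..T} in lebesgue.
       (\<xi> has_vector_derivative proj_op S E (\<xi> t) (f (\<xi> t))) (at t within {0..T})) \<and>
    (\<forall>t\<in>{0..T}. \<xi> t \<in> S)"

text \<open>A solution on \<open>[0,\<infinity>)\<close> is represented by a total function on the reals, whose values at
  negative times are irrelevant.\<close>

definition caratheodory_solution ::
  "'a::real_normed_vector set \<Rightarrow> 'a set \<Rightarrow> ('a \<Rightarrow> 'a) \<Rightarrow> (real \<Rightarrow> 'a) \<Rightarrow> bool" where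
  "caratheodory_solution S E f \<xi> \<longleftrightarrow> (\<forall>T>0. caratheodory_solution_on S E f T \<xi>)"

definition sector :: "real \<Rightarrow> real \<Rightarrow> (real \<times> real) set" where
  "sector k1 k2 = {(e, u). (u - k1 * e) * (u - k2 * e) \<le> 0}"

text \<open>The index type of the controller state is linearly ordered so that it has a first
  coordinate. The state space \<open>\<real>\<^bsup>n+m\<^esup>\<close> is the product of the two Euclidean spaces, whose
  norm is the Euclidean one.\<close>

definition first_component :: "real ^ 'm::{finite,linorder} \<Rightarrow> real" where
  "first_component z = z $ Min UNIV"

definition plant_output :: "real ^ 'n ^ 1 \<Rightarrow> real ^ 'n::finite \<Rightarrow> real" where
  "plant_output G x = (G *v x) $ 1"

definition constraint_set ::
  "real ^ 'n ^ 1 \<Rightarrow> real \<Rightarrow> real \<Rightarrow> ((real ^ 'n::finite) \<times> (real ^ 'm::{finite,linorder})) set" where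
  "constraint_set G k1 k2 = {(x, z). (plant_output G x, first_component z) \<in> sector k1 k2}"

definition correction_subspace ::
  "((real ^ 'n::finite) \<times> (real ^ 'm::finite)) set" where
  "correction_subspace = {0} \<times> UNIV"

definition closed_loop ::
  "((real ^ 'n) \<times> real \<Rightarrow> real ^ 'n) \<Rightarrow> ((real ^ 'm::{finite,linorder}) \<times> real \<Rightarrow> real ^ 'm::{finite,linorder}) \<Rightarrow>
   real ^ 'n ^ 1 \<Rightarrow>
   (real ^ 'n::finite) \<times> (real ^ 'm::{finite,linorder}) \<Rightarrow>
   (real ^ 'n) \<times> (real ^ 'm::{finite,linorder})" where
  "closed_loop fp fc G = (\<lambda>(x, z). (fp (x, first_component z), fc (z, plant_output G x)))"

end

theory Submission
  imports Defs "HOL-Complex_Analysis.Great_Picard"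
begin

text \<open>The velocity of the system is discontinuous on the boundary of the sector, so the solution is built as
  a limit of explicit Euler polygons in which each step is followed by clipping the coordinate
  \<open>u = z\<^sub>1\<close> to the interval that the sector allows for the current output \<open>e = G x\<close>. Since
  clipping changes neither \<open>e\<close> nor the other coordinates, each step ends in the constraint set, and the
  correction is of the order of the step size, so that linear growth bounds the polygons and makes them
  equicontinuous on bounded time intervals. A subsequence converges to a locally Lipschitz curve in the
  constraint set (\<open>one_step_scheme_limit\<close>).

  The limit inherits every closed convex constraint on the step velocities. All coordinates except
  \<open>u\<close> follow the given vector field without correction, so they are differentiable at every positive
  time; in particular \<open>e\<close> is. Where \<open>(e, u)\<close> is strictly inside the sector, no correction
  happens and \<open>u\<close> follows the vector field as well (\<open>proj_op_interior\<close>). The difficulty is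
  the set of times at which \<open>u = k * e\<close> for \<open>k\<close> one of the two slopes, about which nothing is
  known except that it is closed. There the Lipschitz function \<open>u - k * e\<close> vanishes, and a
  Lipschitz function has derivative zero at almost every point of its zero set
  (\<open>AE_has_derivative_zero_on_zero_set\<close>), because the exceptional zeros form countably many porous sets. Hence \<open>u\<close> is differentiable there with derivative
  \<open>k\<close> times the derivative of \<open>e\<close>.

  It remains to see that this velocity is the minimizer that defines the projection
  (\<open>proj_op_boundary\<close>). Corrections on one boundary line push \<open>u\<close> in one direction only, which is
  a half-space constraint and thus passes to the limit; together with the shape of the tangent cone it
  says that the velocity of \<open>u\<close> is the admissible one nearest to the desired velocity. At the apex
  \<open>e = u = 0\<close>, where the tangent cone need not be convex, almost every time has zero derivative of both gaps
  \<open>u - k1 * e\<close> and \<open>u - k2 * e\<close>; thus \<open>e\<close> and \<open>u\<close> are at rest and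
  the admissible velocity is unique.\<close>

section \<open>Porous sets and zero sets of Lipschitz functions\<close>

text \<open>The ball of radius \<open>2 \<bar>s - x\<bar>\<close> around \<open>x\<close> contains the hole around \<open>s\<close>, whose length is
  the fraction \<open>\<theta> / 2\<close> of the length of that ball.\<close>
lemma emeasure_porous_Int_le:
  fixes x s r \<theta> :: real and P :: "real set"
  assumes P: "P \<in> sets lebesgue" and r: "r = 2 * \<bar>s - x\<bar>" and "s \<noteq> x" and \<theta>: "0 < \<theta>" "\<theta> \<le> 1"
    and gap: "P \<inter> ball s (\<theta> * \<bar>s - x\<bar>) = {}"
  shows "emeasure lebesgue (P \<inter> cball x r) \<le> ennreal (1 - \<theta> / 2) * emeasure lebesgue (cball x r)"
proof -
  define d where "d = \<bar>s - x\<bar>"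
  have d: "d > 0" "r = 2 * d" using assms by (auto simp: d_def)
  have sub: "ball s (\<theta> * d) \<subseteq> cball x r"
  proof
    fix t assume "t \<in> ball s (\<theta> * d)"
    then have "\<bar>s - t\<bar> < \<theta> * d" by (simp add: dist_real_def)
    moreover have "\<theta> * d \<le> 1 * d" using \<theta> d by (intro mult_right_mono) auto
    ultimately have "\<bar>s - t\<bar> < d" by simp
    then have "\<bar>x - t\<bar> \<le> r"
      using d(2) abs_triangle_ineq4[of "s - t" "s - x"] unfolding d_def by (simp add: algebra_simps)
    then show "t \<in> cball x r" by (simp add: dist_real_def)
  qed
  have "emeasure lebesgue (P \<inter> cball x r) \<le> emeasure lebesgue (cball x r - ball s (\<theta> * d))"
    using gap P by (intro emeasure_mono) (auto simp: d_def)
  also have "\<dots> = emeasure lebesgue (cball x r) - emeasure lebesgue (ball s (\<theta> * d))"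
    using sub d \<theta> by (intro emeasure_Diff) (auto simp: ball_eq_greaterThanLessThan)
  also have "\<dots> = ennreal (2 * r) - ennreal (2 * (\<theta> * d))"
    using d \<theta> by (simp add: ball_eq_greaterThanLessThan cball_eq_atLeastAtMost)
  also have "\<dots> = ennreal (2 * r - 2 * (\<theta> * d))"
    using d \<theta> by (intro ennreal_minus) simp
  also have "2 * r - 2 * (\<theta> * d) = (1 - \<theta> / 2) * (2 * r)" using d by (simp add: algebra_simps)
  also have "ennreal \<dots> = ennreal (1 - \<theta> / 2) * ennreal (2 * r)"
    using \<theta> d by (intro ennreal_mult) auto
  also have "ennreal (2 * r) = emeasure lebesgue (cball x r)"
    using d by (simp add: cball_eq_atLeastAtMost)
  finally show ?thesis .
qed

text \<open>Inside an open superset \<open>V\<close> of almost the same measure as \<open>P\<close>, the Vitali theorem provides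
  disjoint balls that cover almost all of \<open>P\<close>. A fixed fraction of each ball misses \<open>P\<close>, so that
  \<open>P\<close> has at most \<open>1 - \<theta> / 2\<close> times the measure of \<open>V\<close>, which is impossible for positive
  measure once \<open>V\<close> is close enough to \<open>P\<close>.\<close>
lemma negligible_porous:
  fixes P :: "real set" and \<theta> :: real
  assumes P: "P \<in> lmeasurable" and \<theta>: "0 < \<theta>" "\<theta> \<le> 1"
    and porous: "\<And>x \<delta>. x \<in> P \<Longrightarrow> \<delta> > 0 \<Longrightarrow>
      \<exists>s. s \<noteq> x \<and> \<bar>s - x\<bar> < \<delta> \<and> P \<inter> ball s (\<theta> * \<bar>s - x\<bar>) = {}"
  shows "negligible P"
proof -
  define q where "q = 1 - \<theta> / 2"
  have q: "0 \<le> q" "q < 1" using \<theta> by (auto simp: q_def)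
  have step: "measure lebesgue P \<le> q * (measure lebesgue P + \<eta>)" if "\<eta> > 0" for \<eta>
  proof -
    have Pm: "P \<in> sets lebesgue" using P by auto
    obtain V where V: "open V" "P \<subseteq> V" and VP: "V - P \<in> lmeasurable" "emeasure lebesgue (V - P) < ennreal \<eta>"
      using sets_lebesgue_outer_open[OF Pm \<open>\<eta> > 0\<close>] by metis
    have PV: "P \<union> (V - P) = V" using V by auto
    have Vm: "V \<in> lmeasurable" using fmeasurable.Un[OF P VP(1)] unfolding PV .
    have "measure lebesgue V \<le> measure lebesgue P + measure lebesgue (V - P)"
      using measure_Un_le[OF Pm fmeasurableD[OF VP(1)]] unfolding PV .
    also have "measure lebesgue (V - P) < \<eta>"
      using VP that by (simp add: emeasure_eq_measure2 ennreal_less_iff)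
    finally have V\<eta>: "measure lebesgue V \<le> measure lebesgue P + \<eta>" by simp
    define K where "K = {(x, r). x \<in> P \<and> 0 < r \<and> cball x r \<subseteq> V \<and>
        (\<exists>s. s \<noteq> x \<and> r = 2 * \<bar>s - x\<bar> \<and> P \<inter> ball s (\<theta> * \<bar>s - x\<bar>) = {})}"
    obtain C where C: "countable C" "C \<subseteq> K"
      and disj: "pairwise (\<lambda>i j. disjnt (cball (fst i) (snd i)) (cball (fst j) (snd j))) C"
      and N: "negligible (P - (\<Union>i\<in>C. cball (fst i) (snd i)))"
    proof (rule Vitali_covering_theorem_cballs[of K snd P fst])
      show "0 < snd i" if "i \<in> K" for i using that by (auto simp: K_def)
      show "\<exists>i. i \<in> K \<and> x \<in> cball (fst i) (snd i) \<and> snd i < d" if x: "x \<in> P" "0 < d" for x d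
      proof -
        obtain \<rho> where \<rho>: "\<rho> > 0" "ball x \<rho> \<subseteq> V"
          using V x by (meson open_contains_ball subsetD)
        obtain s where s: "s \<noteq> x" "\<bar>s - x\<bar> < min d \<rho> / 2" "P \<inter> ball s (\<theta> * \<bar>s - x\<bar>) = {}"
          using porous[OF x(1), of "min d \<rho> / 2"] x \<rho> by auto
        have "cball x (2 * \<bar>s - x\<bar>) \<subseteq> V" using s \<rho> by auto
        then have "(x, 2 * \<bar>s - x\<bar>) \<in> K" using x s by (auto simp: K_def)
        then show ?thesis using s by (intro exI[of _ "(x, 2 * \<bar>s - x\<bar>)"]) auto
      qed
    qed
    define B where "B i = cball (fst i) (snd i)" for i :: "real \<times> real"
    have dB: "disjoint_family_on B C"
      using disj by (auto simp: disjoint_family_on_def pairwise_def disjnt_def B_def)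
    have dPB: "disjoint_family_on (\<lambda>i. P \<inter> B i) C"
      unfolding disjoint_family_on_def
    proof (intro ballI impI)
      fix i j assume "i \<in> C" "j \<in> C" "i \<noteq> j"
      then have "B i \<inter> B j = {}" using dB by (simp add: disjoint_family_on_def)
      then show "(P \<inter> B i) \<inter> (P \<inter> B j) = {}" by auto
    qed
    have Um: "(\<Union>i\<in>C. P \<inter> B i) \<in> sets lebesgue"
      using C Pm by (intro sets.countable_UN'') (auto simp: B_def)
    have N': "P - (\<Union>i\<in>C. B i) \<in> null_sets lebesgue"
      using N by (simp add: B_def negligible_iff_null_sets)
    have "emeasure lebesgue P \<le> emeasure lebesgue ((\<Union>i\<in>C. P \<inter> B i) \<union> (P - (\<Union>i\<in>C. B i)))"
      using Um N' by (intro emeasure_mono) (auto dest: null_setsD2)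
    also have "\<dots> = emeasure lebesgue (\<Union>i\<in>C. P \<inter> B i)"
      using Um N' by (rule emeasure_Un_null_set)
    also have "\<dots> = (\<integral>\<^sup>+ i. emeasure lebesgue (P \<inter> B i) \<partial>count_space C)"
      using C Pm dPB by (intro emeasure_UN_countable) (auto simp: B_def)
    also have "\<dots> \<le> (\<integral>\<^sup>+ i. ennreal q * emeasure lebesgue (B i) \<partial>count_space C)"
    proof (intro nn_integral_mono)
      fix i assume "i \<in> space (count_space C)"
      then have "i \<in> K" using C by auto
      then obtain s where "snd i = 2 * \<bar>s - fst i\<bar>" "s \<noteq> fst i"
        "P \<inter> ball s (\<theta> * \<bar>s - fst i\<bar>) = {}" by (auto simp: K_def)
      from emeasure_porous_Int_le[OF Pm this(1,2) \<theta> this(3)]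
      show "emeasure lebesgue (P \<inter> B i) \<le> ennreal q * emeasure lebesgue (B i)"
        by (simp add: B_def q_def)
    qed
    also have "\<dots> = ennreal q * emeasure lebesgue (\<Union>i\<in>C. B i)"
      using C dB by (subst emeasure_UN_countable) (auto simp: B_def nn_integral_cmult)
    also have "\<dots> \<le> ennreal q * emeasure lebesgue V"
      using C V by (intro mult_left_mono emeasure_mono) (auto simp: B_def K_def subset_iff)
    finally have "ennreal (measure lebesgue P) \<le> ennreal (q * measure lebesgue V)"
      using P Vm q by (simp add: emeasure_eq_measure2 ennreal_mult)
    then have "measure lebesgue P \<le> q * measure lebesgue V"
      using q by (simp add: ennreal_le_iff)
    also have "\<dots> \<le> q * (measure lebesgue P + \<eta>)" using V\<eta> q by (intro mult_left_mono) auto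
    finally show ?thesis .
  qed
  have "measure lebesgue P \<le> q * measure lebesgue P + \<eta>" if "\<eta> > 0" for \<eta>
  proof -
    have "q * \<eta> \<le> 1 * \<eta>" using q that by (intro mult_right_mono) auto
    then show ?thesis using step[OF that] by (simp add: algebra_simps)
  qed
  then have "measure lebesgue P \<le> q * measure lebesgue P" by (rule field_le_epsilon)
  then have "(1 - q) * measure lebesgue P \<le> 0" by (simp add: algebra_simps)
  then have "measure lebesgue P = 0"
    using q by (smt (verit) measure_nonneg mult_pos_pos)
  then show ?thesis using P by (simp add: negligible_iff_measure0)
qed

text \<open>Zeros at which \<open>0\<close> is not the derivative have, for some \<open>\<epsilon>\<close>, arbitrarily close points \<open>s\<close> with
  \<open>\<epsilon> \<bar>s - t\<bar> < \<bar>g s\<bar>\<close>. The Lipschitz bound keeps \<open>g\<close> away from zero on a ball around \<open>s\<close> of radius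
  proportional to \<open>\<bar>s - t\<bar>\<close>, so that for each \<open>\<epsilon>\<close> these zeros form a porous set. This takes
  the place of the differentiability almost everywhere of Lipschitz functions.\<close>
lemma AE_has_derivative_zero_on_zero_set:
  fixes g :: "real \<Rightarrow> real"
  assumes lip: "L-lipschitz_on {a<..<b} g"
  shows "AE t in lebesgue. t \<in> {a<..<b} \<longrightarrow> g t = 0 \<longrightarrow> (g has_real_derivative 0) (at t)"
proof -
  let ?I = "{a<..<b}"
  have cont: "continuous_on ?I g" using lip by (rule lipschitz_on_continuous_on)
  define U where "U \<epsilon> n = (\<Union>s\<in>?I. {t. \<bar>s - t\<bar> < 1 / Suc n \<and> \<epsilon> * \<bar>s - t\<bar> < \<bar>g s\<bar>})" for \<epsilon> :: real and n
  define P where "P \<epsilon> = {t \<in> ?I. g t = 0} \<inter> (\<Inter>n. U \<epsilon> n)" for \<epsilon>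
  have negl: "negligible (P \<epsilon>)" if \<epsilon>: "\<epsilon> > 0" for \<epsilon>
  proof (rule negligible_porous)
    have U: "open (U \<epsilon> n)" for n
      unfolding U_def by (intro open_UN ballI open_Collect_conj open_Collect_less continuous_intros)
    have "open {t \<in> ?I. g t \<noteq> 0}"
    proof -
      have "{t \<in> ?I. g t \<noteq> 0} = ?I \<inter> g -` (- {0})" by auto
      then show ?thesis using continuous_open_preimage[OF cont open_greaterThanLessThan, of "- {0}"] by auto
    qed
    then have "?I - {t \<in> ?I. g t \<noteq> 0} \<in> sets borel" by (intro sets.Diff borel_open) auto
    moreover have "?I - {t \<in> ?I. g t \<noteq> 0} = {t \<in> ?I. g t = 0}" by auto
    ultimately have "{t \<in> ?I. g t = 0} \<in> sets borel" by simp
    moreover have "(\<Inter>n. U \<epsilon> n) \<in> sets borel" by (intro sets.countable_INT'') (auto intro: borel_open U)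
    ultimately have "P \<epsilon> \<in> sets borel" unfolding P_def by (rule sets.Int)
    then have "P \<epsilon> \<in> sets lebesgue" by simp
    moreover have "bounded (P \<epsilon>)"
      by (rule bounded_subset[OF bounded_closed_interval[of a b]]) (auto simp: P_def)
    ultimately show "P \<epsilon> \<in> lmeasurable" by (intro bounded_set_imp_lmeasurable)
    \<comment> \<open>\<open>L + 1\<close> instead of \<open>L\<close> avoids a division by zero.\<close>
    define \<theta> where "\<theta> = min 1 (\<epsilon> / (L + 1))"
    have L: "L \<ge> 0" using lip by (rule lipschitz_on_nonneg)
    show "0 < \<theta>" "\<theta> \<le> 1" using \<epsilon> L by (auto simp: \<theta>_def)
    show "\<exists>s. s \<noteq> x \<and> \<bar>s - x\<bar> < \<delta> \<and> P \<epsilon> \<inter> ball s (\<theta> * \<bar>s - x\<bar>) = {}"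
      if x: "x \<in> P \<epsilon>" and \<delta>: "\<delta> > 0" for x \<delta>
    proof -
      obtain n where n: "1 / Suc n < \<delta>" using \<delta> by (metis inverse_eq_divide reals_Archimedean)
      have "x \<in> U \<epsilon> n" "g x = 0" using x by (auto simp: P_def)
      then obtain s where s: "s \<in> ?I" "\<bar>s - x\<bar> < 1 / Suc n" "\<epsilon> * \<bar>s - x\<bar> < \<bar>g s\<bar>"
        by (auto simp: U_def)
      have sx: "s \<noteq> x" using s \<open>g x = 0\<close> by auto
      have "t \<notin> P \<epsilon>" if t: "t \<in> ball s (\<theta> * \<bar>s - x\<bar>)" for t
      proof
        assume "t \<in> P \<epsilon>"
        then have tI: "t \<in> ?I" "g t = 0" by (auto simp: P_def)
        have "\<bar>g s\<bar> = dist (g s) (g t)" using tI by (simp add: dist_real_def)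
        also have "\<dots> \<le> L * dist s t" using lip s tI by (meson lipschitz_onD)
        also have "\<dots> \<le> (L + 1) * (\<theta> * \<bar>s - x\<bar>)"
          using t L by (intro mult_mono) auto
        also have "\<dots> \<le> (L + 1) * (\<epsilon> / (L + 1) * \<bar>s - x\<bar>)"
          using L by (intro mult_left_mono mult_right_mono) (auto simp: \<theta>_def)
        also have "\<dots> = \<epsilon> * \<bar>s - x\<bar>" using L by simp
        finally show False using s by simp
      qed
      then show ?thesis using sx s n by (intro exI[of _ s]) auto
    qed
  qed
  have "negligible (\<Union>k. P (1 / real (Suc k)))"
    by (intro negligible_countable_Union) (auto intro: negl)
  then have "AE t in lebesgue. t \<notin> (\<Union>k. P (1 / real (Suc k)))"
    unfolding negligible_iff_null_sets by (rule AE_not_in)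
  then show ?thesis
  proof (eventually_elim, intro impI)
    fix t assume t: "t \<notin> (\<Union>k. P (1 / real (Suc k)))" "t \<in> ?I" "g t = 0"
    show "(g has_real_derivative 0) (at t)"
      unfolding has_field_derivative_iff
    proof (rule tendstoI)
      fix \<epsilon> :: real assume "\<epsilon> > 0"
      then obtain k where k: "1 / real (Suc k) < \<epsilon>" by (metis inverse_eq_divide reals_Archimedean)
      obtain n where n: "t \<notin> U (1 / real (Suc k)) n" using t by (auto simp: P_def)
      have "\<forall>\<^sub>F s in at t. s \<in> ?I" using t by (intro eventually_at_in_open') auto
      moreover have "\<forall>\<^sub>F s in at t. s \<in> ball t (1 / Suc n)" by (intro eventually_at_in_open') auto
      moreover have "\<forall>\<^sub>F s in at t. s \<noteq> t" by (simp add: eventually_at_filter)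
      ultimately show "\<forall>\<^sub>F s in at t. dist ((g s - g t) / (s - t)) 0 < \<epsilon>"
      proof eventually_elim
        case (elim s)
        then have "\<bar>s - t\<bar> < 1 / Suc n" by (simp add: dist_real_def abs_minus_commute)
        then have "\<bar>g s\<bar> \<le> 1 / real (Suc k) * \<bar>s - t\<bar>"
          using n elim unfolding U_def by force
        then have "\<bar>g s\<bar> / \<bar>s - t\<bar> \<le> 1 / real (Suc k)" using elim by (simp add: divide_simps)
        then show ?case using k t by (simp add: abs_divide)
      qed
    qed
  qed
qed

section \<open>Limits of one-step schemes\<close>

text \<open>What holds eventually for this filter holds for all steps of sufficiently small size that a scheme
  takes close to the state \<open>y\<close>.\<close>
definition one_step_filter :: "'a::topological_space set \<Rightarrow> 'a \<Rightarrow> (real \<times> 'a) filter" where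
  "one_step_filter S y = at_right 0 \<times>\<^sub>F inf (nhds y) (principal S)"

lemma eventually_one_step_filter_metric:
  fixes y :: "'a::metric_space"
  shows "eventually P (one_step_filter S y) \<longleftrightarrow>
    (\<exists>\<delta>>0. \<forall>h \<eta>. 0 < h \<longrightarrow> h < \<delta> \<longrightarrow> \<eta> \<in> S \<longrightarrow> dist \<eta> y < \<delta> \<longrightarrow> P (h, \<eta>))"
proof
  assume "eventually P (one_step_filter S y)"
  then obtain Pf Pg where f: "eventually Pf (at_right (0::real))"
    and g: "eventually Pg (inf (nhds y) (principal S))" and P: "\<And>h \<eta>. Pf h \<Longrightarrow> Pg \<eta> \<Longrightarrow> P (h, \<eta>)"
    unfolding one_step_filter_def eventually_prod_filter by auto
  from f obtain b where b: "b > 0" "\<And>h. 0 < h \<Longrightarrow> h < b \<Longrightarrow> Pf h"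
    unfolding eventually_at_right_field by auto
  from g obtain d where d: "d > 0" "\<And>\<eta>. dist \<eta> y < d \<Longrightarrow> \<eta> \<in> S \<Longrightarrow> Pg \<eta>"
    unfolding eventually_inf_principal eventually_nhds_metric by auto
  show "\<exists>\<delta>>0. \<forall>h \<eta>. 0 < h \<longrightarrow> h < \<delta> \<longrightarrow> \<eta> \<in> S \<longrightarrow> dist \<eta> y < \<delta> \<longrightarrow> P (h, \<eta>)"
    using b d by (intro exI[of _ "min b d"]) (auto intro!: P)
next
  assume "\<exists>\<delta>>0. \<forall>h \<eta>. 0 < h \<longrightarrow> h < \<delta> \<longrightarrow> \<eta> \<in> S \<longrightarrow> dist \<eta> y < \<delta> \<longrightarrow> P (h, \<eta>)"
  then obtain \<delta> where d: "\<delta> > 0" "\<And>h \<eta>. 0 < h \<Longrightarrow> h < \<delta> \<Longrightarrow> \<eta> \<in> S \<Longrightarrow> dist \<eta> y < \<delta> \<Longrightarrow> P (h, \<eta>)"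
    by auto
  have "eventually (\<lambda>h. 0 < h \<and> h < \<delta>) (at_right (0::real))"
    using d(1) unfolding eventually_at_right_field by auto
  moreover have "eventually (\<lambda>\<eta>. \<eta> \<in> S \<and> dist \<eta> y < \<delta>) (inf (nhds y) (principal S))"
    using d(1) unfolding eventually_inf_principal eventually_nhds_metric by auto
  ultimately show "eventually P (one_step_filter S y)"
    unfolding one_step_filter_def eventually_prod_filter
    by (intro exI[of _ "\<lambda>h. 0 < h \<and> h < \<delta>"] exI[of _ "\<lambda>\<eta>. \<eta> \<in> S \<and> dist \<eta> y < \<delta>"]) (auto intro: d(2))
qed

text \<open>The discrete Gronwall inequality, for increments of linear growth.\<close>
lemma norm_iterates_le_exp:
  fixes X :: "nat \<Rightarrow> 'a::real_normed_vector"
  assumes "\<And>k. norm (X (Suc k) - X k) \<le> h * (C * (1 + norm (X k)))" "0 \<le> h" "0 \<le> C"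
  shows "1 + norm (X k) \<le> (1 + norm (X 0)) * exp (C * (real k * h))"
proof (induction k)
  case (Suc k)
  have "1 + norm (X (Suc k)) \<le> 1 + norm (X k) + norm (X (Suc k) - X k)"
    using norm_triangle_sub[of "X (Suc k)" "X k"] by simp
  also have "\<dots> \<le> (1 + norm (X k)) * (1 + C * h)" using assms(1)[of k] by (simp add: algebra_simps)
  also have "\<dots> \<le> ((1 + norm (X 0)) * exp (C * (real k * h))) * exp (C * h)"
    using Suc assms exp_ge_add_one_self[of "C * h"] by (intro mult_mono) auto
  also have "\<dots> = (1 + norm (X 0)) * exp (C * (real (Suc k) * h))"
    by (simp add: exp_add[symmetric] algebra_simps)
  finally show ?case .
qed simp

lemma norm_diff_le_sum_increments:
  fixes X :: "nat \<Rightarrow> 'a::real_normed_vector"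
  assumes "j \<le> k" "\<And>i. j \<le> i \<Longrightarrow> i < k \<Longrightarrow> norm (X (Suc i) - X i) \<le> B"
  shows "norm (X k - X j) \<le> real (k - j) * B"
proof -
  have "norm (X k - X j) = norm (\<Sum>i=j..<k. X (Suc i) - X i)" using assms(1) by (simp add: sum_Suc_diff')
  also have "\<dots> \<le> (\<Sum>i=j..<k. B)" by (intro sum_norm_le) (auto intro: assms)
  finally show ?thesis by simp
qed

text \<open>The difference quotient over several steps is the average of the quotients over the single steps.\<close>
lemma mean_increment_in_convex:
  fixes X :: "nat \<Rightarrow> 'a::real_vector"
  assumes "convex D" "j < k" "h > 0" "\<And>i. j \<le> i \<Longrightarrow> i < k \<Longrightarrow> (X (Suc i) - X i) /\<^sub>R h \<in> D"
  shows "(X k - X j) /\<^sub>R (real (k - j) * h) \<in> D"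
proof -
  have "(\<Sum>i=j..<k. (1 / real (k - j)) *\<^sub>R ((X (Suc i) - X i) /\<^sub>R h)) \<in> D"
    using assms by (intro convex_sum) auto
  also have "(\<Sum>i=j..<k. (1 / real (k - j)) *\<^sub>R ((X (Suc i) - X i) /\<^sub>R h))
      = (1 / (real (k - j) * h)) *\<^sub>R (\<Sum>i=j..<k. X (Suc i) - X i)"
    by (simp add: scaleR_sum_right divide_inverse)
  also have "\<dots> = (X k - X j) /\<^sub>R (real (k - j) * h)"
    using assms(2) by (simp add: sum_Suc_diff' divide_inverse)
  finally show ?thesis .
qed

text \<open>A version of the Arzela--Ascoli theorem for step functions, which are Lipschitz only up to the
  mesh \<open>h n\<close>. A diagonal subsequence converges at all rational times, and near-equicontinuity makes it
  a Cauchy sequence at every other time. Since the bound \<open>R\<close> depends on the time, it is divided out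
  before the diagonal subsequence is chosen.\<close>
lemma approx_Lipschitz_convergent_subseq:
  fixes y :: "nat \<Rightarrow> real \<Rightarrow> 'a::euclidean_space" and R L :: "real \<Rightarrow> real"
  assumes R: "\<And>t. t \<ge> 0 \<Longrightarrow> R t > 0" and bound: "\<And>n t. t \<ge> 0 \<Longrightarrow> norm (y n t) \<le> R t"
    and h: "h \<longlonglongrightarrow> 0"
    and lip: "\<And>n s t T. 0 \<le> s \<Longrightarrow> s \<le> t \<Longrightarrow> t \<le> T \<Longrightarrow> norm (y n t - y n s) \<le> L T * (t - s + h n)"
  obtains \<rho> \<xi> where "strict_mono \<rho>" "\<And>t. t \<ge> 0 \<Longrightarrow> (\<lambda>n. y (\<rho> n) t) \<longlonglongrightarrow> \<xi> t"
proof -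
  define Q where "Q = (\<rat> \<inter> {0..} :: real set)"
  have "countable Q" unfolding Q_def by (simp add: countable_Int1 countable_rat)
  moreover have "norm (y n x /\<^sub>R R x) \<le> 1" if "x \<in> Q" for n x
    using R[of x] bound[of x n] that by (simp add: Q_def divide_simps abs_of_pos)
  ultimately obtain \<rho> where \<rho>: "strict_mono \<rho>"
    and conv: "\<And>x. x \<in> Q \<Longrightarrow> \<exists>l. (\<lambda>n. y (\<rho> n) x /\<^sub>R R x) \<longlonglongrightarrow> l"
    using function_convergent_subsequence[of Q "\<lambda>n x. y n x /\<^sub>R R x" 1] by metis
  have h\<rho>: "(\<lambda>n. h (\<rho> n)) \<longlonglongrightarrow> 0" using LIMSEQ_subseq_LIMSEQ[OF h \<rho>] by (simp add: o_def)
  have "convergent (\<lambda>n. y (\<rho> n) t)" if t: "t \<ge> 0" for t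
  proof (rule Cauchy_convergent, rule metric_CauchyI)
    fix e :: real assume e: "e > 0"
    define M where "M = \<bar>L (t + 1)\<bar> + 1"
    define d where "d = min 1 (e / (8 * M))"
    have M: "M > 0" "L (t + 1) \<le> M" by (auto simp: M_def)
    have d: "d > 0" using e M by (simp add: d_def)
    obtain q where q: "q \<in> \<rat>" "t < q" "q < t + d" using Rats_dense_in_real[of t "t + d"] d by auto
    then have "q \<in> Q" using t by (auto simp: Q_def)
    then obtain l where l: "(\<lambda>n. y (\<rho> n) q /\<^sub>R R q) \<longlonglongrightarrow> l" using conv by blast
    have "R q > 0" using R[of q] t q by simp
    then have "(\<lambda>n. y (\<rho> n) q) \<longlonglongrightarrow> R q *\<^sub>R l"
      using tendsto_scaleR[OF tendsto_const[of "R q"] l] by simp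
    then have "Cauchy (\<lambda>n. y (\<rho> n) q)" by (rule LIMSEQ_imp_Cauchy)
    then obtain N1 where N1: "\<And>m n. m \<ge> N1 \<Longrightarrow> n \<ge> N1 \<Longrightarrow> dist (y (\<rho> m) q) (y (\<rho> n) q) < e / 4"
      using e by (meson Cauchy_def divide_pos_pos zero_less_numeral)
    obtain N2 where N2: "\<And>n. n \<ge> N2 \<Longrightarrow> \<bar>h (\<rho> n)\<bar> < d"
      using LIMSEQ_D[OF h\<rho> d] by auto
    have near: "dist (y (\<rho> n) t) (y (\<rho> n) q) \<le> e / 4" if "n \<ge> N2" for n
    proof -
      have "dist (y (\<rho> n) t) (y (\<rho> n) q) \<le> L (t + 1) * (q - t + h (\<rho> n))"
        using lip[of t q "t + 1" "\<rho> n"] t q by (simp add: dist_norm norm_minus_commute d_def)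
      also have "\<dots> \<le> \<bar>L (t + 1) * (q - t + h (\<rho> n))\<bar>" by simp
      also have "\<dots> \<le> M * (2 * d)"
        unfolding abs_mult using N2[OF that] q by (intro mult_mono) (auto simp: M_def)
      also have "\<dots> \<le> M * (2 * (e / (8 * M)))"
        using M by (intro mult_left_mono) (auto simp: d_def)
      also have "\<dots> = e / 4" using M by simp
      finally show ?thesis .
    qed
    show "\<exists>N. \<forall>m\<ge>N. \<forall>n\<ge>N. dist (y (\<rho> m) t) (y (\<rho> n) t) < e"
    proof (intro exI[of _ "max N1 N2"] allI impI)
      fix m n assume mn: "m \<ge> max N1 N2" "n \<ge> max N1 N2"
      have "dist (y (\<rho> m) t) (y (\<rho> n) t) \<le> dist (y (\<rho> m) t) (y (\<rho> m) q)
          + dist (y (\<rho> m) q) (y (\<rho> n) q) + dist (y (\<rho> n) t) (y (\<rho> n) q)"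
        using dist_triangle[of "y (\<rho> m) t" "y (\<rho> n) t" "y (\<rho> m) q"]
          dist_triangle[of "y (\<rho> m) q" "y (\<rho> n) t" "y (\<rho> n) q"] by (simp add: dist_commute)
      then show "dist (y (\<rho> m) t) (y (\<rho> n) t) < e"
        using near[of m] near[of n] N1[of m n] mn e by simp
    qed
  qed
  then have "\<And>t. t \<ge> 0 \<Longrightarrow> (\<lambda>n. y (\<rho> n) t) \<longlonglongrightarrow> lim (\<lambda>n. y (\<rho> n) t)"
    by (simp add: convergent_LIMSEQ_iff)
  with \<rho> show ?thesis by (rule that)
qed

text \<open>Every closed convex constraint that the step velocities satisfy near \<open>\<xi> t0\<close> holds for the
  difference quotients of \<open>\<xi>\<close> near \<open>t0\<close>. This is the form in which the dynamics of a scheme survive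
  in its limit; it covers equations as well as one-sided inequalities for the velocity.\<close>
definition increments_inherited ::
    "'a::real_normed_vector set \<Rightarrow> (real \<Rightarrow> 'a \<Rightarrow> 'a) \<Rightarrow> (real \<Rightarrow> 'a) \<Rightarrow> real \<Rightarrow> bool" where
  "increments_inherited S \<Phi> \<xi> t0 \<longleftrightarrow>
    (\<forall>D. closed D \<longrightarrow> convex D \<longrightarrow>
       eventually (\<lambda>(h, \<eta>). \<Phi> h \<eta> \<in> D) (one_step_filter S (\<xi> t0)) \<longrightarrow>
       (\<exists>\<delta>>0. \<forall>s t. 0 \<le> s \<longrightarrow> t0 - \<delta> < s \<longrightarrow> s < t \<longrightarrow> t < t0 + \<delta> \<longrightarrow>
          (\<xi> t - \<xi> s) /\<^sub>R (t - s) \<in> D))"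

text \<open>The piecewise constant interpolations of the iterates are bounded by the Gronwall inequality and
  Lipschitz up to the mesh, hence a subsequence converges. Difference quotients of the interpolations
  are averages of step velocities at nearby states, which lie in \<open>D\<close> by convexity; closedness carries
  this over to the limit.\<close>
lemma one_step_scheme_limit:
  fixes \<Phi> :: "real \<Rightarrow> 'a::euclidean_space \<Rightarrow> 'a" and \<xi>0 :: 'a
  assumes "closed S" and "\<xi>0 \<in> S" and "C \<ge> 0"
    and viable: "\<And>h \<eta>. h > 0 \<Longrightarrow> \<eta> \<in> S \<Longrightarrow> \<eta> + h *\<^sub>R \<Phi> h \<eta> \<in> S"
    and growth: "\<And>h \<eta>. h > 0 \<Longrightarrow> \<eta> \<in> S \<Longrightarrow> norm (\<Phi> h \<eta>) \<le> C * (1 + norm \<eta>)"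
  obtains \<xi> where "\<xi> 0 = \<xi>0" "\<And>t. t \<ge> 0 \<Longrightarrow> \<xi> t \<in> S"
    "\<And>T. T \<ge> 0 \<Longrightarrow> \<exists>L. L-lipschitz_on {0..T} \<xi>"
    "\<And>t0. t0 \<ge> 0 \<Longrightarrow> increments_inherited S \<Phi> \<xi> t0"
proof -
  define h where "h n = 1 / (real n + 1)" for n
  define X where "X n k = ((\<lambda>\<eta>. \<eta> + h n *\<^sub>R \<Phi> (h n) \<eta>) ^^ k) \<xi>0" for n k
  define ix where "ix n t = nat \<lfloor>t / h n\<rfloor>" for n t
  define y where "y n t = X n (ix n t)" for n t
  define R where "R t = (1 + norm \<xi>0) * exp (C * t)" for t
  have h_pos: "h n > 0" for n by (simp add: h_def)
  have h_lim: "h \<longlonglongrightarrow> 0" unfolding h_def by real_asymp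
  have X0: "X n 0 = \<xi>0" for n by (simp add: X_def)
  have XS: "X n k \<in> S" for n k
    by (induction k) (auto simp: X_def assms h_pos intro!: viable)
  have inc: "X n (Suc k) - X n k = h n *\<^sub>R \<Phi> (h n) (X n k)" for n k by (simp add: X_def)
  have inc_le: "norm (X n (Suc k) - X n k) \<le> h n * (C * (1 + norm (X n k)))" for n k
    unfolding inc using growth[OF h_pos XS] h_pos[of n] by (simp add: less_imp_le mult_left_mono)
  have R_mono: "R s \<le> R t" if "s \<le> t" for s t
    using that \<open>C \<ge> 0\<close> unfolding R_def by (intro mult_left_mono) (auto intro: mult_left_mono)
  have R_pos: "R t > 0" for t unfolding R_def by (intro mult_pos_pos) (auto intro: add_pos_nonneg)
  have X_le: "1 + norm (X n k) \<le> R t" if "real k * h n \<le> t" for n k t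
    using norm_iterates_le_exp[of "X n" "h n" C k] inc_le h_pos[of n] \<open>C \<ge> 0\<close> R_mono[OF that]
    by (simp add: X0 R_def less_imp_le)
  have ix_le: "real (ix n t) * h n \<le> t" if "t \<ge> 0" for n t
  proof -
    have "real (ix n t) \<le> t / h n" using that h_pos[of n] by (simp add: ix_def)
    then show ?thesis using h_pos[of n] by (simp add: field_simps)
  qed
  have ix_gt: "t < real (ix n t) * h n + h n" if "t \<ge> 0" for n t
  proof -
    have "t / h n < real (ix n t) + 1" using that h_pos[of n] by (simp add: ix_def)
    then show ?thesis using h_pos[of n] by (simp add: field_simps)
  qed
  have ix_mono: "ix n s \<le> ix n t" if "s \<le> t" for n s t
    unfolding ix_def using that h_pos[of n] by (intro nat_mono floor_mono divide_right_mono) auto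
  define L where "L T = C * R T" for T
  have L_nonneg: "L T \<ge> 0" for T using \<open>C \<ge> 0\<close> R_pos[of T] by (simp add: L_def)
  have X_diff: "norm (X n k - X n j) \<le> L T * (real k * h n - real j * h n)"
    if "j \<le> k" "real k * h n \<le> T" for n j k T
  proof -
    have "norm (X n k - X n j) \<le> real (k - j) * (h n * L T)"
    proof (rule norm_diff_le_sum_increments[OF \<open>j \<le> k\<close>])
      fix i assume "j \<le> i" "i < k"
      then have "real i * h n \<le> real k * h n" using h_pos[of n] by (intro mult_right_mono) auto
      then have "1 + norm (X n i) \<le> R T" using that by (intro X_le) auto
      then have "h n * (C * (1 + norm (X n i))) \<le> h n * L T"
        using h_pos[of n] \<open>C \<ge> 0\<close> unfolding L_def by (intro mult_left_mono) auto
      with inc_le[of n i] show "norm (X n (Suc i) - X n i) \<le> h n * L T" by linarith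
    qed
    also have "\<dots> = L T * (real k * h n - real j * h n)"
      using that by (simp add: of_nat_diff algebra_simps)
    finally show ?thesis .
  qed
  have y_diff: "norm (y n t - y n s) \<le> L T * (t - s + h n)" if "0 \<le> s" "s \<le> t" "t \<le> T" for n s t T
  proof -
    have "norm (y n t - y n s) \<le> L T * (real (ix n t) * h n - real (ix n s) * h n)"
      unfolding y_def using that ix_le[of t n] by (intro X_diff ix_mono) auto
    also have "\<dots> \<le> L T * (t - s + h n)"
      using ix_le[of t n] ix_gt[of s n] that L_nonneg[of T] by (intro mult_left_mono) auto
    finally show ?thesis .
  qed
  have y_bound: "norm (y n t) \<le> R t" if "t \<ge> 0" for n t
    using X_le[OF ix_le[OF that, of n]] by (simp add: y_def)
  obtain \<rho> \<xi> where \<rho>: "strict_mono \<rho>" and lim: "\<And>t. t \<ge> 0 \<Longrightarrow> (\<lambda>n. y (\<rho> n) t) \<longlonglongrightarrow> \<xi> t"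
    using approx_Lipschitz_convergent_subseq[of R y h L, OF R_pos y_bound h_lim y_diff] by blast
  have h\<rho>: "(\<lambda>n. h (\<rho> n)) \<longlonglongrightarrow> 0" using LIMSEQ_subseq_LIMSEQ[OF h_lim \<rho>] by (simp add: o_def)
  show thesis
  proof (rule that)
    have "(\<lambda>n. y (\<rho> n) 0) \<longlonglongrightarrow> \<xi>0" by (simp add: y_def ix_def X0)
    then show "\<xi> 0 = \<xi>0" using lim[of 0] LIMSEQ_unique by blast
    show "\<xi> t \<in> S" if "t \<ge> 0" for t
      using closed_sequentially[OF \<open>closed S\<close> _ lim[OF that]] by (simp add: y_def XS)
    show "\<exists>L. L-lipschitz_on {0..T} \<xi>" if "T \<ge> 0" for T
    proof (intro exI lipschitz_onI)
      have *: "norm (\<xi> t - \<xi> s) \<le> L T * (t - s)" if "0 \<le> s" "s \<le> t" "t \<le> T" for s t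
      proof (rule LIMSEQ_le)
        show "(\<lambda>n. norm (y (\<rho> n) t - y (\<rho> n) s)) \<longlonglongrightarrow> norm (\<xi> t - \<xi> s)"
          using that by (intro tendsto_intros lim) auto
        have "(\<lambda>n. L T * (t - s + h (\<rho> n))) \<longlonglongrightarrow> L T * (t - s + 0)"
          by (intro tendsto_intros h\<rho>)
        then show "(\<lambda>n. L T * (t - s + h (\<rho> n))) \<longlonglongrightarrow> L T * (t - s)" by simp
      qed (use y_diff that in auto)
      show "dist (\<xi> s) (\<xi> t) \<le> L T * dist s t" if "s \<in> {0..T}" "t \<in> {0..T}" for s t
        using *[of s t] *[of t s] that
        by (cases "s \<le> t") (auto simp: dist_norm norm_minus_commute abs_real_def)
    qed (rule L_nonneg)
  next
    fix t0 :: real assume t0: "t0 \<ge> 0"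
    show "increments_inherited S \<Phi> \<xi> t0"
      unfolding increments_inherited_def
    proof (intro allI impI)
      fix D assume D: "closed D" "convex D"
        and ev: "eventually (\<lambda>(h, \<eta>). \<Phi> h \<eta> \<in> D) (one_step_filter S (\<xi> t0))"
      obtain \<epsilon> where \<epsilon>: "\<epsilon> > 0"
        "\<And>h \<eta>. 0 < h \<Longrightarrow> h < \<epsilon> \<Longrightarrow> \<eta> \<in> S \<Longrightarrow> dist \<eta> (\<xi> t0) < \<epsilon> \<Longrightarrow> \<Phi> h \<eta> \<in> D"
        using ev unfolding eventually_one_step_filter_metric by auto
      \<comment> \<open>For \<open>s, t\<close> within \<open>\<delta>\<close> of \<open>t0\<close> and mesh below \<open>\<delta>\<close>, the iterates in between stay
        within \<open>4 M \<delta> \<le> \<epsilon> / 2\<close> of the interpolation at \<open>t0\<close>; the other half of \<open>\<epsilon>\<close> is for its convergence.\<close>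
      define M where "M = L (t0 + 1) + 1"
      define \<delta> where "\<delta> = min 1 (min \<epsilon> (\<epsilon> / (8 * M)))"
      have M: "M > 0" "L (t0 + 1) \<le> M" using L_nonneg[of "t0 + 1"] by (auto simp: M_def)
      have \<delta>: "\<delta> > 0" "\<delta> \<le> 1" "\<delta> \<le> \<epsilon>" "M * (4 * \<delta>) \<le> \<epsilon> / 2"
        using \<epsilon> M by (auto simp: \<delta>_def min_def field_simps)
      show "\<exists>\<delta>>0. \<forall>s t. 0 \<le> s \<longrightarrow> t0 - \<delta> < s \<longrightarrow> s < t \<longrightarrow> t < t0 + \<delta> \<longrightarrow> (\<xi> t - \<xi> s) /\<^sub>R (t - s) \<in> D"
      proof (intro exI[of _ \<delta>] conjI allI impI \<delta>(1))
        fix s t assume st: "0 \<le> s" "t0 - \<delta> < s" "s < t" "t < t0 + \<delta>"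
        define w where "w n = real (ix n t - ix n s) * h n" for n
        have w: "(\<lambda>n. w (\<rho> n)) \<longlonglongrightarrow> t - s"
        proof (rule tendsto_sandwich[of "\<lambda>n. t - s - h (\<rho> n)" _ _ "\<lambda>n. t - s + h (\<rho> n)"])
          show "(\<lambda>n. t - s - h (\<rho> n)) \<longlonglongrightarrow> t - s" using tendsto_diff[OF tendsto_const h\<rho>] by simp
          show "(\<lambda>n. t - s + h (\<rho> n)) \<longlonglongrightarrow> t - s" using tendsto_add[OF tendsto_const h\<rho>] by simp
          have "t - s - h n \<le> w n \<and> w n \<le> t - s + h n" for n
            using ix_le[of t n] ix_gt[of t n] ix_le[of s n] ix_gt[of s n] st ix_mono[of s t n]
            by (simp add: w_def of_nat_diff algebra_simps)
          then show "\<forall>\<^sub>F n in sequentially. t - s - h (\<rho> n) \<le> w (\<rho> n)"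
            "\<forall>\<^sub>F n in sequentially. w (\<rho> n) \<le> t - s + h (\<rho> n)" by auto
        qed
        have "\<forall>\<^sub>F n in sequentially. h (\<rho> n) < \<delta>"
          using order_tendstoD(2)[OF h\<rho> \<delta>(1)] .
        moreover have "\<forall>\<^sub>F n in sequentially. h (\<rho> n) < t - s"
          using order_tendstoD(2)[OF h\<rho>, of "t - s"] st by simp
        moreover have "\<forall>\<^sub>F n in sequentially. dist (y (\<rho> n) t0) (\<xi> t0) < \<epsilon> / 2"
          using tendstoD[OF lim[OF t0], of "\<epsilon> / 2"] \<epsilon> by simp
        ultimately have "\<forall>\<^sub>F n in sequentially. (y (\<rho> n) t - y (\<rho> n) s) /\<^sub>R w (\<rho> n) \<in> D"
        proof eventually_elim
          case (elim n)
          let ?n = "\<rho> n"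
          have "ix ?n s < ix ?n t"
          proof (rule ccontr)
            assume "\<not> ix ?n s < ix ?n t"
            then have "ix ?n s = ix ?n t" using ix_mono[of s t ?n] st by simp
            then show False using ix_le[of s ?n] ix_gt[of t ?n] elim st by simp
          qed
          then show ?case unfolding y_def w_def
          proof (rule mean_increment_in_convex[OF D(2) _ h_pos])
            fix i assume i: "ix ?n s \<le> i" "i < ix ?n t"
            have "real (ix ?n s) * h ?n \<le> real i * h ?n" "real i * h ?n \<le> real (ix ?n t) * h ?n"
              using i h_pos[of ?n] by (auto intro!: mult_right_mono)
            then have ih: "s - h ?n \<le> real i * h ?n" "real i * h ?n \<le> t"
              using ix_gt[of s ?n] ix_le[of t ?n] st by auto
            \<comment> \<open>The iterate number \<open>i\<close> is the interpolation at the grid point \<open>i h\<close>, so the Lipschitz bound applies to it.\<close>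
            have yi: "X ?n i = y ?n (real i * h ?n)" using h_pos[of ?n] by (simp add: y_def ix_def)
            have "dist (X ?n i) (y ?n t0) \<le> L (t0 + 1) * (\<bar>real i * h ?n - t0\<bar> + h ?n)"
              using y_diff[of "real i * h ?n" t0 "t0 + 1" ?n] y_diff[of t0 "real i * h ?n" "t0 + 1" ?n]
                h_pos[of ?n] ih st t0 \<delta> unfolding yi
              by (cases "real i * h ?n \<le> t0") (auto simp: dist_norm norm_minus_commute abs_real_def)
            also have "\<dots> \<le> M * (4 * \<delta>)"
              using M ih st elim h_pos[of ?n] by (intro mult_mono) auto
            finally have "dist (X ?n i) (\<xi> t0) < \<epsilon>"
              using elim \<delta>(4) dist_triangle[of "X ?n i" "\<xi> t0" "y ?n t0"] by simp
            then have "\<Phi> (h ?n) (X ?n i) \<in> D"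
              using elim \<delta> by (intro \<epsilon>(2) XS h_pos) auto
            then show "(X ?n (Suc i) - X ?n i) /\<^sub>R h ?n \<in> D" using h_pos[of ?n] by (simp add: inc)
          qed
        qed
        moreover have "(\<lambda>n. (y (\<rho> n) t - y (\<rho> n) s) /\<^sub>R w (\<rho> n)) \<longlonglongrightarrow> (\<xi> t - \<xi> s) /\<^sub>R (t - s)"
          using st by (intro tendsto_intros lim w) auto
        ultimately show "(\<xi> t - \<xi> s) /\<^sub>R (t - s) \<in> D"
          using D(1) by (intro Lim_in_closed_set[where F = sequentially]) auto
      qed
    qed
  qed
qed

lemma has_vector_derivative_iff_quotient:
  fixes f :: "real \<Rightarrow> 'a::real_normed_vector"
  shows "(f has_vector_derivative w) (at t) \<longleftrightarrow> ((\<lambda>s. (f s - f t) /\<^sub>R (s - t)) \<longlongrightarrow> w) (at t)"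
proof -
  have "(f has_vector_derivative w) (at t) \<longleftrightarrow>
      ((\<lambda>s. norm (f s - f t - (s - t) *\<^sub>R w) / norm (s - t)) \<longlongrightarrow> 0) (at t)"
    by (simp add: has_vector_derivative_def has_derivative_iff_norm bounded_linear_scaleR_left)
  also have "\<dots> \<longleftrightarrow> ((\<lambda>s. norm ((f s - f t) /\<^sub>R (s - t) - w)) \<longlongrightarrow> 0) (at t)"
  proof (intro filterlim_cong refl)
    show "\<forall>\<^sub>F s in at t. norm (f s - f t - (s - t) *\<^sub>R w) / norm (s - t)
        = norm ((f s - f t) /\<^sub>R (s - t) - w)"
    proof (rule eventually_mono)
      show "\<forall>\<^sub>F s in at t. s \<noteq> t" by (simp add: eventually_at_filter)
      fix s assume "s \<noteq> t"
      then have "(f s - f t) /\<^sub>R (s - t) - w = (f s - f t - (s - t) *\<^sub>R w) /\<^sub>R (s - t)"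
        by (simp add: scaleR_diff_right)
      then show "norm (f s - f t - (s - t) *\<^sub>R w) / norm (s - t) = norm ((f s - f t) /\<^sub>R (s - t) - w)"
        by (simp add: divide_inverse_commute)
    qed
  qed
  also have "\<dots> \<longleftrightarrow> ((\<lambda>s. (f s - f t) /\<^sub>R (s - t)) \<longlongrightarrow> w) (at t)"
    by (simp add: tendsto_norm_zero_iff LIM_zero_iff)
  finally show ?thesis .
qed

text \<open>The preimages under \<open>A\<close> of small balls around \<open>a\<close> are closed and convex, so the difference
  quotients of \<open>\<xi>\<close> enter each of them. A component along which the scheme is consistent with a vector
  field is thus differentiable at every positive time, not only almost everywhere.\<close>
lemma vector_derivative_inherited:
  fixes \<xi> :: "real \<Rightarrow> 'a::real_normed_vector" and A :: "'a \<Rightarrow> 'b::real_normed_vector"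
  assumes inh: "increments_inherited S \<Phi> \<xi> t" and "t > 0" and A: "bounded_linear A"
    and lim: "((\<lambda>(h, \<eta>). A (\<Phi> h \<eta>)) \<longlongrightarrow> a) (one_step_filter S (\<xi> t))"
  shows "((\<lambda>s. A (\<xi> s)) has_vector_derivative a) (at t)"
  unfolding has_vector_derivative_iff_quotient
proof (rule tendstoI)
  interpret A: bounded_linear A by (rule A)
  fix e :: real assume "e > 0"
  define D where "D = A -` cball a (e / 2)"
  have "closed D" unfolding D_def by (intro closed_vimage A.continuous_on continuous_on_id) auto
  moreover have "convex D" unfolding D_def by (intro convex_linear_vimage A.linear_axioms convex_cball)
  moreover have "eventually (\<lambda>(h, \<eta>). \<Phi> h \<eta> \<in> D) (one_step_filter S (\<xi> t))"
    using tendstoD[OF lim, of "e / 2"] \<open>e > 0\<close>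
    by (auto elim!: eventually_mono simp: D_def dist_commute less_imp_le)
  ultimately obtain \<delta> where \<delta>: "\<delta> > 0" and
    *: "\<And>s r. 0 \<le> s \<Longrightarrow> t - \<delta> < s \<Longrightarrow> s < r \<Longrightarrow> r < t + \<delta> \<Longrightarrow> (\<xi> r - \<xi> s) /\<^sub>R (r - s) \<in> D"
    using inh unfolding increments_inherited_def by blast
  have "\<forall>\<^sub>F s in at t. s \<in> {max 0 (t - \<delta>)<..<t + \<delta>}"
    using \<delta> \<open>t > 0\<close> by (intro eventually_at_in_open') auto
  moreover have "\<forall>\<^sub>F s in at t. s \<noteq> t" by (simp add: eventually_at_filter)
  ultimately show "\<forall>\<^sub>F s in at t. dist ((A (\<xi> s) - A (\<xi> t)) /\<^sub>R (s - t)) a < e"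
  proof eventually_elim
    case (elim s)
    have "(\<xi> s - \<xi> t) /\<^sub>R (s - t) \<in> D"
    proof (cases "s < t")
      case True
      then have "(\<xi> t - \<xi> s) /\<^sub>R (t - s) \<in> D" using elim \<delta> by (intro *) auto
      also have "(\<xi> t - \<xi> s) /\<^sub>R (t - s) = (\<xi> s - \<xi> t) /\<^sub>R (s - t)"
      proof -
        have "inverse (t - s) = - inverse (s - t)" by (metis inverse_minus_eq minus_diff_eq)
        then show ?thesis by (simp add: algebra_simps)
      qed
      finally show ?thesis .
    next
      case False
      then show ?thesis using elim \<delta> \<open>t > 0\<close> by (intro *) auto
    qed
    then show ?case using \<open>e > 0\<close> by (simp add: D_def A.scaleR A.diff dist_commute)
  qed
qed

lemma has_vector_derivative_inherited_in:
  fixes \<xi> :: "real \<Rightarrow> 'a::real_normed_vector"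
  assumes inh: "increments_inherited S \<Phi> \<xi> t" and "t > 0" and D: "closed D" "convex D"
    and ev: "eventually (\<lambda>(h, \<eta>). \<Phi> h \<eta> \<in> D) (one_step_filter S (\<xi> t))"
    and w: "(\<xi> has_vector_derivative w) (at t)"
  shows "w \<in> D"
proof -
  obtain \<delta> where \<delta>: "\<delta> > 0" and
    *: "\<And>s r. 0 \<le> s \<Longrightarrow> t - \<delta> < s \<Longrightarrow> s < r \<Longrightarrow> r < t + \<delta> \<Longrightarrow> (\<xi> r - \<xi> s) /\<^sub>R (r - s) \<in> D"
    using inh D ev unfolding increments_inherited_def by blast
  have "((\<lambda>s. (\<xi> s - \<xi> t) /\<^sub>R (s - t)) \<longlongrightarrow> w) (at_right t)"
    using w unfolding has_vector_derivative_iff_quotient by (rule filterlim_mono) (auto simp: at_le)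
  moreover have "\<forall>\<^sub>F s in at_right t. (\<xi> s - \<xi> t) /\<^sub>R (s - t) \<in> D"
    unfolding eventually_at_right_field using \<delta> \<open>t > 0\<close> by (intro exI[of _ "t + \<delta>"]) (auto intro!: *)
  ultimately show ?thesis using D by (intro Lim_in_closed_set[where F = "at_right t"]) auto
qed

section \<open>Tangent cones and projected velocities\<close>

lemma has_vector_derivative_in_tangent_cone:
  fixes \<xi> :: "real \<Rightarrow> 'a::real_normed_vector"
  assumes w: "(\<xi> has_vector_derivative w) (at t)" and S: "\<And>s. s \<ge> t \<Longrightarrow> \<xi> s \<in> S"
  shows "w \<in> tangent_cone S (\<xi> t)"
proof -
  define \<tau> where "\<tau> i = 1 / (real i + 1)" for i
  have \<tau>: "\<tau> i > 0" for i by (simp add: \<tau>_def)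
  have \<tau>0: "\<tau> \<longlonglongrightarrow> 0" unfolding \<tau>_def by real_asymp
  have "(\<lambda>i. t + \<tau> i) \<longlonglongrightarrow> t + 0" by (intro tendsto_intros \<tau>0)
  then have lim: "filterlim (\<lambda>i. t + \<tau> i) (at t) sequentially"
    using \<tau> by (auto simp: filterlim_at less_imp_neq[symmetric])
  have "isCont \<xi> t" using w by (rule has_vector_derivative_continuous)
  then have "(\<lambda>i. \<xi> (t + \<tau> i)) \<longlonglongrightarrow> \<xi> t"
    using filterlim_compose[OF _ lim, of \<xi> "nhds (\<xi> t)"] by (simp add: isCont_def)
  moreover have "(\<lambda>i. (\<xi> (t + \<tau> i) - \<xi> t) /\<^sub>R \<tau> i) \<longlonglongrightarrow> w"
    using filterlim_compose[OF w[unfolded has_vector_derivative_iff_quotient] lim] by simp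
  moreover have "decseq \<tau>" unfolding \<tau>_def by (intro decseq_SucI) (simp add: field_simps)
  ultimately show ?thesis
    unfolding tangent_cone_def using \<tau> \<tau>0 S
    by (auto intro!: exI[of _ "\<lambda>i. \<xi> (t + \<tau> i)"] exI[of _ \<tau>] simp: less_imp_le)
qed

text \<open>A linear inequality that is active at \<open>y\<close> and valid on \<open>S\<close> near \<open>y\<close> passes to the quotients
  that define the tangent cone.\<close>
lemma tangent_cone_linear_le:
  fixes g :: "'a::real_normed_vector \<Rightarrow> real"
  assumes "w \<in> tangent_cone S y" and g: "bounded_linear g"
    and loc: "eventually (\<lambda>\<eta>. \<eta> \<in> S \<longrightarrow> g \<eta> \<le> 0) (nhds y)" and "g y = 0"
  shows "g w \<le> 0"
proof -
  interpret g: bounded_linear g by (rule g)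
  obtain z \<tau> where z: "\<And>i. z i \<in> S" "\<And>i::nat. \<tau> i > (0::real)" "z \<longlonglongrightarrow> y"
    "(\<lambda>i. (z i - y) /\<^sub>R \<tau> i) \<longlonglongrightarrow> w" using assms(1) unfolding tangent_cone_def by auto
  have "(\<lambda>i. g ((z i - y) /\<^sub>R \<tau> i)) \<longlonglongrightarrow> g w" by (intro g.tendsto z)
  moreover have "\<forall>\<^sub>F i in sequentially. g ((z i - y) /\<^sub>R \<tau> i) \<le> 0"
    using filterlim_iff[THEN iffD1, OF z(3), rule_format, OF loc]
  proof eventually_elim
    case (elim i)
    then show ?case using z(1,2)[of i] \<open>g y = 0\<close>
      by (auto simp: g.scaleR g.diff intro!: mult_nonneg_nonpos)
  qed
  ultimately show ?thesis by (rule tendsto_upperbound) auto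
qed

text \<open>At an apex \<open>y\<close> of \<open>S\<close> the defining quotients are themselves points of \<open>S\<close>.\<close>
lemma tangent_cone_subset_cone_at_apex:
  fixes S :: "'a::real_normed_vector set"
  assumes w: "w \<in> tangent_cone S y" and "closed S"
    and cone: "\<And>\<eta> c. \<eta> \<in> S \<Longrightarrow> c > 0 \<Longrightarrow> c *\<^sub>R (\<eta> - y) \<in> S"
  shows "w \<in> S"
proof -
  obtain z \<tau> where z: "\<And>i. z i \<in> S" "\<And>i::nat. \<tau> i > (0::real)"
    "(\<lambda>i. (z i - y) /\<^sub>R \<tau> i) \<longlonglongrightarrow> w" using w unfolding tangent_cone_def by auto
  then have "(z i - y) /\<^sub>R \<tau> i \<in> S" for i by (intro cone) auto
  then show ?thesis using closed_sequentially[OF \<open>closed S\<close> _ z(3)] by blast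
qed

lemma proj_op_eqI:
  assumes "w \<in> tangent_cone S y" "w - v \<in> E"
    and "\<And>w'. w' \<in> tangent_cone S y \<Longrightarrow> w' - v \<in> E \<Longrightarrow> norm (w' - v) \<le> norm (w - v) \<Longrightarrow> w' = w"
  shows "proj_op S E y v = w"
proof -
  let ?P = "\<lambda>w. w \<in> tangent_cone S y \<and> w - v \<in> E"
  have iff: "is_arg_min (\<lambda>w. norm (w - v)) ?P x \<longleftrightarrow> x = w" for x
  proof
    assume "is_arg_min (\<lambda>w. norm (w - v)) ?P x"
    then show "x = w" using assms unfolding is_arg_min_def by (meson not_less)
  next
    assume "x = w"
    then show "is_arg_min (\<lambda>w. norm (w - v)) ?P x"
      using assms unfolding is_arg_min_def by (metis less_imp_le less_irrefl)
  qed
  show ?thesis unfolding proj_op_def arg_min_def iff by simp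
qed

section \<open>Clipping to a sector\<close>

text \<open>For a fixed first coordinate \<open>r\<close> the sector is the interval between \<open>k1 * r\<close> and \<open>k2 * r\<close>, in
  an order that depends on the sign of \<open>r\<close>; this is the point of that interval nearest to \<open>x\<close>.\<close>
definition sector_clip :: "real \<Rightarrow> real \<Rightarrow> real \<Rightarrow> real \<Rightarrow> real" where
  "sector_clip k1 k2 r x = max (min (k1 * r) (k2 * r)) (min x (max (k1 * r) (k2 * r)))"

lemma sector_clip_in_sector: "(r, sector_clip k1 k2 r x) \<in> sector k1 k2"
  unfolding sector_def sector_clip_def by (auto simp: max_def min_def mult_le_0_iff)

lemma sector_clip_le_self: "k \<in> {k1, k2} \<Longrightarrow> k * r \<le> x \<Longrightarrow> sector_clip k1 k2 r x \<le> x"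
  unfolding sector_clip_def by auto

lemma self_le_sector_clip: "k \<in> {k1, k2} \<Longrightarrow> x \<le> k * r \<Longrightarrow> x \<le> sector_clip k1 k2 r x"
  unfolding sector_clip_def by auto

text \<open>The interval moves with speed at most \<open>\<bar>k1\<bar> + \<bar>k2\<bar>\<close> in \<open>r\<close>. Hence a point that has left the sector
  by a small move can be brought back by a move of the same order.\<close>
lemma sector_clip_dist_le:
  assumes "(r, x) \<in> sector k1 k2"
  shows "\<bar>sector_clip k1 k2 r' x' - x'\<bar> \<le> \<bar>x' - x\<bar> + (\<bar>k1\<bar> + \<bar>k2\<bar>) * \<bar>r' - r\<bar>"
proof -
  have lo: "min (k1 * r) (k2 * r) \<le> x" and up: "x \<le> max (k1 * r) (k2 * r)"
    using assms unfolding sector_def by (auto simp: mult_le_0_iff)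
  have d: "\<bar>k * r' - k * r\<bar> \<le> (\<bar>k1\<bar> + \<bar>k2\<bar>) * \<bar>r' - r\<bar>" if "k \<in> {k1, k2}" for k
  proof -
    have "\<bar>k * r' - k * r\<bar> = \<bar>k\<bar> * \<bar>r' - r\<bar>" by (simp add: right_diff_distrib[symmetric] abs_mult)
    also have "\<dots> \<le> (\<bar>k1\<bar> + \<bar>k2\<bar>) * \<bar>r' - r\<bar>" using that by (intro mult_right_mono) auto
    finally show ?thesis .
  qed
  define \<delta> where "\<delta> = (\<bar>k1\<bar> + \<bar>k2\<bar>) * \<bar>r' - r\<bar>"
  have d1: "\<bar>k1 * r' - k1 * r\<bar> \<le> \<delta>" and d2: "\<bar>k2 * r' - k2 * r\<bar> \<le> \<delta>"
    using d[of k1] d[of k2] by (auto simp: \<delta>_def)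
  have abstract: "\<bar>max l' (min x' u') - x'\<bar> \<le> \<bar>x' - x\<bar> + \<delta>"
    if "l' \<le> u'" "l \<le> x" "x \<le> u" "l' \<le> l + \<delta>" "u \<le> u' + \<delta>" "0 \<le> \<delta>" for l u l' u' \<delta> :: real
    using that by (cases "x' \<le> l'"; cases "x' \<le> u'") auto
  show ?thesis unfolding sector_clip_def \<delta>_def[symmetric]
  proof (rule abstract[OF _ lo up])
    show "min (k1 * r') (k2 * r') \<le> min (k1 * r) (k2 * r) + \<delta>"
      using d1 d2 unfolding min_def by auto
    show "max (k1 * r) (k2 * r) \<le> max (k1 * r') (k2 * r') + \<delta>"
      using d1 d2 unfolding max_def by auto
    show "0 \<le> \<delta>" using d1 by linarith
  qed auto
qed

section \<open>Systems projected onto a sector constraint\<close>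

lemma lipschitz_imp_abs_continuous:
  fixes \<xi> :: "real \<Rightarrow> 'a::real_normed_vector"
  assumes L: "L-lipschitz_on {A..B} \<xi>"
  shows "abs_continuous_on_Icc A B \<xi>"
  unfolding abs_continuous_on_Icc_def
proof (intro allI impI)
  fix \<epsilon> :: real assume "\<epsilon> > 0"
  have L0: "L \<ge> 0" using L by (rule lipschitz_on_nonneg)
  have "(\<Sum>i<N. norm (\<xi> (b i) - \<xi> (a i))) < \<epsilon>"
    if ab: "\<forall>i<N. A \<le> a i \<and> a i \<le> b i \<and> b i \<le> B" and less: "(\<Sum>i<N. b i - a i) < \<epsilon> / (L + 1)"
    for N :: nat and a b :: "nat \<Rightarrow> real"
  proof -
    have "(\<Sum>i<N. norm (\<xi> (b i) - \<xi> (a i))) \<le> (\<Sum>i<N. L * (b i - a i))"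
    proof (intro sum_mono)
      fix i assume "i \<in> {..<N}"
      then have "A \<le> a i" "a i \<le> b i" "b i \<le> B" using ab by auto
      then show "norm (\<xi> (b i) - \<xi> (a i)) \<le> L * (b i - a i)"
        using lipschitz_onD[OF L, of "b i" "a i"] by (simp add: dist_norm)
    qed
    also have "\<dots> \<le> (L + 1) * (\<Sum>i<N. b i - a i)"
      unfolding sum_distrib_left using ab by (intro sum_mono mult_right_mono) auto
    also have "\<dots> < (L + 1) * (\<epsilon> / (L + 1))" using less L0 by (intro mult_strict_left_mono) auto
    also have "\<dots> = \<epsilon>" using L0 by simp
    finally show ?thesis .
  qed
  then show "\<exists>\<delta>>0. \<forall>(N::nat) a b. (\<forall>i<N. A \<le> a i \<and> a i \<le> b i \<and> b i \<le> B) \<and>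
      disjoint_family_on (\<lambda>i. {a i<..<b i}) {..<N} \<and> (\<Sum>i<N. b i - a i) < \<delta> \<longrightarrow>
      (\<Sum>i<N. norm (\<xi> (b i) - \<xi> (a i))) < \<epsilon>"
    using \<open>\<epsilon> > 0\<close> L0 by (intro exI[of _ "\<epsilon> / (L + 1)"]) auto
qed

text \<open>The constraint only involves the output \<open>e\<close> and the coordinate \<open>u = \<eta> \<bullet> b\<close> along a unit vector
  \<open>b\<close>, and corrections along \<open>b\<close> are admissible while no admissible correction changes \<open>e\<close>. All that
  matters about the splitting into plant and controller is contained in these assumptions.\<close>
locale projected_sector_system =
  fixes e :: "'a::euclidean_space \<Rightarrow> real" and b :: 'a and k1 k2 :: real
    and F :: "'a \<Rightarrow> 'a" and E :: "'a set"
  assumes lin_e: "bounded_linear e" and norm_b: "norm b = 1" and k_less: "k1 < k2"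
    and b_in_E: "\<And>c. c *\<^sub>R b \<in> E" and e_zero_on_E: "\<And>d. d \<in> E \<Longrightarrow> e d = 0"
    and cont_F: "continuous_on UNIV F"
begin

sublocale e: bounded_linear e by (rule lin_e)

definition S :: "'a set" where "S = {\<eta>. (e \<eta>, \<eta> \<bullet> b) \<in> sector k1 k2}"

text \<open>Membership in the sector is the inequality \<open>gap k1 * gap k2 \<le> 0\<close>, and the two boundary lines are
  the zero sets of the two gaps.\<close>
definition gap :: "real \<Rightarrow> 'a \<Rightarrow> real" where "gap k \<eta> = \<eta> \<bullet> b - k * e \<eta>"

definition free_part :: "'a \<Rightarrow> 'a" where "free_part v = v - (v \<bullet> b) *\<^sub>R b"

text \<open>An explicit Euler step followed by clipping along \<open>b\<close>. Since \<open>e b = 0\<close>, the clipping leaves the output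
  and hence the interval it aims at unchanged, so that a single clipping restores the constraint.\<close>
definition step_velocity :: "real \<Rightarrow> 'a \<Rightarrow> 'a" where
  "step_velocity h \<eta> = F \<eta> + ((sector_clip k1 k2 (e (\<eta> + h *\<^sub>R F \<eta>)) ((\<eta> + h *\<^sub>R F \<eta>) \<bullet> b)
      - (\<eta> + h *\<^sub>R F \<eta>) \<bullet> b) / h) *\<^sub>R b"

lemma e_b [simp]: "e b = 0"
  using e_zero_on_E[OF b_in_E[of 1]] by simp

lemma b_b [simp]: "b \<bullet> b = 1"
  using norm_b by (simp add: norm_eq_1)

lemma bounded_linear_free_part: "bounded_linear free_part"
  unfolding free_part_def by (intro bounded_linear_intros)

lemma bounded_linear_gap: "bounded_linear (gap k)"
  unfolding gap_def by (intro bounded_linear_intros lin_e)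

lemma continuous_e [continuous_intros]: "continuous_on A f \<Longrightarrow> continuous_on A (\<lambda>x. e (f x))"
  by (rule e.continuous_on)

lemma free_part_b [simp]: "free_part (c *\<^sub>R b) = 0" by (simp add: free_part_def)

lemma free_part_decomp: "v = free_part v + (v \<bullet> b) *\<^sub>R b" by (simp add: free_part_def)

lemma S_iff: "\<eta> \<in> S \<longleftrightarrow> gap k1 \<eta> * gap k2 \<eta> \<le> 0"
  by (simp add: S_def sector_def gap_def)

lemma closed_S: "closed S"
proof -
  have "closed {\<eta>. gap k1 \<eta> * gap k2 \<eta> \<le> 0}"
    unfolding gap_def by (intro closed_Collect_le continuous_intros)
  also have "{\<eta>. gap k1 \<eta> * gap k2 \<eta> \<le> 0} = S" using S_iff by auto
  finally show ?thesis .
qed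

lemma step_in_S:
  assumes "h > 0" shows "\<eta> + h *\<^sub>R step_velocity h \<eta> \<in> S"
proof -
  let ?z = "\<eta> + h *\<^sub>R F \<eta>"
  have "\<eta> + h *\<^sub>R step_velocity h \<eta> = ?z + (sector_clip k1 k2 (e ?z) (?z \<bullet> b) - ?z \<bullet> b) *\<^sub>R b"
    using assms by (simp add: step_velocity_def scaleR_add_right add.assoc)
  also have "\<dots> \<in> S"
  proof -
    have "e (?z + c *\<^sub>R b) = e ?z" "(?z + (c - ?z \<bullet> b) *\<^sub>R b) \<bullet> b = c" for c
      by (simp_all add: e.add e.scaleR inner_add_left)
    then show ?thesis unfolding S_def mem_Collect_eq by (simp only: sector_clip_in_sector)
  qed
  finally show ?thesis .
qed

text \<open>Before the Euler step the state satisfies the constraint, so the clipping has to undo at most a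
  displacement of order \<open>h\<close>. This keeps the velocity bounded as \<open>h\<close> tends to zero.\<close>
lemma norm_step_le:
  assumes "h > 0" "\<eta> \<in> S"
  shows "norm (step_velocity h \<eta>) \<le> (2 + (\<bar>k1\<bar> + \<bar>k2\<bar>) * onorm e) * norm (F \<eta>)"
proof -
  let ?z = "\<eta> + h *\<^sub>R F \<eta>"
  let ?c = "sector_clip k1 k2 (e ?z) (?z \<bullet> b) - ?z \<bullet> b"
  have "\<bar>?c\<bar> \<le> \<bar>?z \<bullet> b - \<eta> \<bullet> b\<bar> + (\<bar>k1\<bar> + \<bar>k2\<bar>) * \<bar>e ?z - e \<eta>\<bar>"
    using assms by (intro sector_clip_dist_le) (simp add: S_def)
  also have "\<bar>?z \<bullet> b - \<eta> \<bullet> b\<bar> = h * \<bar>F \<eta> \<bullet> b\<bar>"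
    using assms by (simp add: inner_add_left abs_mult)
  also have "\<bar>e ?z - e \<eta>\<bar> = h * \<bar>e (F \<eta>)\<bar>"
    using assms by (simp add: e.add e.scaleR abs_mult)
  finally have "\<bar>?c\<bar> / h \<le> \<bar>F \<eta> \<bullet> b\<bar> + (\<bar>k1\<bar> + \<bar>k2\<bar>) * \<bar>e (F \<eta>)\<bar>"
    using assms by (simp add: field_simps)
  also have "\<dots> \<le> norm (F \<eta>) + (\<bar>k1\<bar> + \<bar>k2\<bar>) * (onorm e * norm (F \<eta>))"
    using Cauchy_Schwarz_ineq2[of "F \<eta>" b] onorm[OF lin_e, of "F \<eta>"] norm_b
    by (intro add_mono mult_left_mono) auto
  finally have "norm ((?c / h) *\<^sub>R b) \<le> norm (F \<eta>) + (\<bar>k1\<bar> + \<bar>k2\<bar>) * (onorm e * norm (F \<eta>))"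
    using norm_b assms by simp
  then show ?thesis
    using norm_triangle_ineq[of "F \<eta>" "(?c / h) *\<^sub>R b"] unfolding step_velocity_def by (simp add: algebra_simps)
qed

lemma e_step [simp]: "e (step_velocity h \<eta>) = e (F \<eta>)"
  by (simp add: step_velocity_def e.add e.scaleR)

lemma free_part_step [simp]: "free_part (step_velocity h \<eta>) = free_part (F \<eta>)"
  by (simp add: step_velocity_def bounded_linear.linear[OF bounded_linear_free_part, THEN linear_add])

lemma filterlim_snd_one_step: "filterlim snd (nhds y) (one_step_filter S y)"
  unfolding one_step_filter_def by (rule filterlim_mono[OF filterlim_snd inf_le1 order_refl])

lemma filterlim_fst_one_step: "filterlim fst (nhds 0) (one_step_filter S (y::'a))"
  unfolding one_step_filter_def by (rule filterlim_mono[OF filterlim_fst at_within_le_nhds order_refl])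

lemma tendsto_F_one_step: "((\<lambda>(h, \<eta>). F \<eta>) \<longlongrightarrow> F y) (one_step_filter S y)"
proof -
  have "isCont F y" using cont_F by (simp add: continuous_on_eq_continuous_at)
  from isCont_tendsto_compose[OF this filterlim_snd_one_step] show ?thesis
    by (simp add: case_prod_unfold)
qed

lemma tendsto_free_step: "((\<lambda>(h, \<eta>). \<eta> + h *\<^sub>R F \<eta>) \<longlongrightarrow> y) (one_step_filter S y)"
proof -
  have "((\<lambda>p. snd p + fst p *\<^sub>R (case p of (h, \<eta>) \<Rightarrow> F \<eta>)) \<longlongrightarrow> y + 0 *\<^sub>R F y) (one_step_filter S y)"
    by (intro tendsto_intros filterlim_snd_one_step filterlim_fst_one_step tendsto_F_one_step)
  then show ?thesis by (simp add: case_prod_unfold)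
qed

lemma eventually_pos_one_step: "eventually (\<lambda>(h, \<eta>). h > 0) (one_step_filter S (y::'a))"
  unfolding eventually_one_step_filter_metric by (auto intro: exI[of _ 1])

lemma eventually_gap_sign:
  assumes "\<sigma> * gap k y > 0"
  shows "eventually (\<lambda>\<eta>. \<sigma> * gap k \<eta> > 0) (nhds y)"
proof -
  have "open {\<eta>. 0 < \<sigma> * gap k \<eta>}"
    unfolding gap_def by (intro open_Collect_less continuous_intros)
  then show ?thesis using assms by (auto simp: eventually_nhds)
qed

lemma eventually_free_step_gap_sign:
  assumes "\<sigma> * gap k y > 0"
  shows "eventually (\<lambda>(h, \<eta>). \<sigma> * gap k (\<eta> + h *\<^sub>R F \<eta>) > 0) (one_step_filter S y)"
  using filterlim_iff[THEN iffD1, OF tendsto_free_step, rule_format, OF eventually_gap_sign[OF assms]]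
  by (simp add: case_prod_unfold)

text \<open>Away from one boundary line the clipping can only push towards that line: on the side where
  \<open>\<sigma> * gap k > 0\<close> the line is at most a bound on \<open>\<sigma> * u\<close> from below, which is not active.\<close>
lemma eventually_step_one_sided:
  assumes k: "k \<in> {k1, k2}" and \<sigma>: "\<sigma> \<in> {-1, 1}" and sgn: "\<sigma> * gap k y > 0"
  shows "eventually (\<lambda>(h, \<eta>). \<sigma> * (step_velocity h \<eta> \<bullet> b) \<le> \<sigma> * (F \<eta> \<bullet> b)) (one_step_filter S y)"
  using eventually_free_step_gap_sign[OF sgn] eventually_pos_one_step
proof eventually_elim
  case (elim p)
  obtain h \<eta> where p: "p = (h, \<eta>)" by fastforce
  let ?z = "\<eta> + h *\<^sub>R F \<eta>"
  let ?c = "sector_clip k1 k2 (e ?z) (?z \<bullet> b) - ?z \<bullet> b"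
  have h: "h > 0" and z: "\<sigma> * gap k ?z > 0" using elim p by auto
  have "\<sigma> * ?c \<le> 0"
  proof (cases "\<sigma> = 1")
    case True
    then show ?thesis using sector_clip_le_self[OF k, of "e ?z" "?z \<bullet> b"] z by (simp add: gap_def)
  next
    case False
    then show ?thesis using self_le_sector_clip[OF k, of "?z \<bullet> b" "e ?z"] z \<sigma> by (simp add: gap_def)
  qed
  then have "\<sigma> * ?c / h \<le> 0" using h by (simp add: divide_nonpos_pos)
  then show ?case by (simp add: p step_velocity_def inner_add_left distrib_left)
qed

text \<open>Strictly inside the sector both one-sided estimates apply, so the steps are not corrected at all.\<close>
lemma proj_op_interior:
  assumes "increments_inherited S step_velocity \<xi> t" "t > 0" and S: "\<And>s. s \<ge> 0 \<Longrightarrow> \<xi> s \<in> S"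
    and int: "gap k1 (\<xi> t) * gap k2 (\<xi> t) < 0"
  shows "(\<xi> has_vector_derivative proj_op S E (\<xi> t) (F (\<xi> t))) (at t)"
proof -
  let ?y = "\<xi> t"
  obtain \<sigma> where \<sigma>: "\<sigma> \<in> {-1, 1 :: real}" "\<sigma> * gap k1 ?y > 0" "(-\<sigma>) * gap k2 ?y > 0"
  proof (cases "gap k1 ?y > 0")
    case True then show ?thesis using int that[of 1] by (auto simp: mult_less_0_iff)
  next
    case False then show ?thesis using int that[of "-1"] by (auto simp: mult_less_0_iff)
  qed
  have s1: "eventually (\<lambda>(h, \<eta>). \<sigma> * (step_velocity h \<eta> \<bullet> b) \<le> \<sigma> * (F \<eta> \<bullet> b)) (one_step_filter S ?y)"
    using \<sigma> by (intro eventually_step_one_sided[where k = k1]) auto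
  have s2: "eventually (\<lambda>(h, \<eta>). - \<sigma> * (step_velocity h \<eta> \<bullet> b) \<le> - \<sigma> * (F \<eta> \<bullet> b)) (one_step_filter S ?y)"
    using \<sigma> by (intro eventually_step_one_sided[where k = k2]) auto
  have "eventually (\<lambda>(h, \<eta>). F \<eta> = step_velocity h \<eta>) (one_step_filter S ?y)"
    using s1 s2
  proof eventually_elim
    case (elim p)
    obtain h \<eta> where p: "p = (h, \<eta>)" by fastforce
    have "step_velocity h \<eta> \<bullet> b = F \<eta> \<bullet> b" using elim \<sigma>(1) p by auto
    then show ?case using free_part_decomp[of "step_velocity h \<eta>"] free_part_decomp[of "F \<eta>"] p by simp
  qed
  then have "((\<lambda>(h, \<eta>). step_velocity h \<eta>) \<longlongrightarrow> F ?y) (one_step_filter S ?y)"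
    by (intro Lim_transform_eventually[OF tendsto_F_one_step]) (auto elim: eventually_mono)
  then have d: "(\<xi> has_vector_derivative F ?y) (at t)"
    using vector_derivative_inherited[OF assms(1,2) bounded_linear_ident] by simp
  then have "F ?y \<in> tangent_cone S ?y"
    using S \<open>t > 0\<close> by (intro has_vector_derivative_in_tangent_cone) auto
  then have "proj_op S E ?y (F ?y) = F ?y"
    using b_in_E[of 0] by (intro proj_op_eqI) auto
  with d show ?thesis by simp
qed

text \<open>Admissible velocities share the output rate \<open>e v\<close>, and the distance of \<open>w\<close> from \<open>v\<close> is the
  distance of their coordinates along \<open>b\<close>. So it suffices to compare these coordinates, and equality of
  the norms forces equality of the vectors.\<close>
lemma proj_op_eq_boundary:
  assumes w: "w \<in> tangent_cone S y" "free_part w = free_part v"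
    and opt: "\<And>w'. w' \<in> tangent_cone S y \<Longrightarrow> e w' = e v \<Longrightarrow>
        \<bar>w' \<bullet> b - v \<bullet> b\<bar> \<le> \<bar>w \<bullet> b - v \<bullet> b\<bar> \<Longrightarrow> w' \<bullet> b = w \<bullet> b"
  shows "proj_op S E y v = w"
proof (rule proj_op_eqI[OF w(1)])
  have wv: "w - v = (w \<bullet> b - v \<bullet> b) *\<^sub>R b"
    using w(2) free_part_decomp[of w] free_part_decomp[of v] by (metis add_diff_cancel_left scaleR_diff_left)
  then show "w - v \<in> E" using b_in_E by metis
  fix w' assume w': "w' \<in> tangent_cone S y" "w' - v \<in> E" "norm (w' - v) \<le> norm (w - v)"
  have "e w' = e v" using e_zero_on_E[OF w'(2)] by (simp add: e.diff)
  have nw: "norm (w - v) = \<bar>w \<bullet> b - v \<bullet> b\<bar>" unfolding wv using norm_b by simp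
  have "\<bar>w' \<bullet> b - v \<bullet> b\<bar> \<le> norm (w' - v)"
    using Cauchy_Schwarz_ineq2[of "w' - v" b] norm_b by (simp add: inner_diff_left)
  then have b: "w' \<bullet> b = w \<bullet> b" using w' nw by (intro opt \<open>e w' = e v\<close>) auto
  have "(norm (w' - w))\<^sup>2 = (norm (w' - v))\<^sup>2 - 2 * ((w' - v) \<bullet> (w - v)) + (norm (w - v))\<^sup>2"
    by (simp add: power2_norm_eq_inner inner_diff_left inner_diff_right inner_commute)
  \<comment> \<open>Both differences have the same component along \<open>b\<close>, and \<open>w - v\<close> has no other component.\<close>
  also have "(w' - v) \<bullet> (w - v) = (w \<bullet> b - v \<bullet> b)\<^sup>2"
    by (subst wv) (simp add: inner_diff_left b power2_eq_square)
  also have "(w \<bullet> b - v \<bullet> b)\<^sup>2 = (norm (w - v))\<^sup>2" by (simp add: nw)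
  also have "(norm (w' - v))\<^sup>2 \<le> (norm (w - v))\<^sup>2" using w'(3) by (intro power_mono) auto
  finally show "w' = w" by simp
qed

text \<open>On the line \<open>u = k * e\<close> the assumed zero derivative of the gap fixes the velocity of \<open>u\<close> to
  \<open>k\<close> times that of \<open>e\<close>. At the apex of the sector both gaps vanish, which forces \<open>e\<close> and \<open>u\<close> to be at
  rest, and no other admissible velocity exists. Elsewhere on the line the tangent cone is a half-space
  on whose boundary the velocity lies, and the one-sided estimate for the steps says that the desired
  velocity lies on its other side or on its boundary, so the velocity is the nearest admissible one.\<close>
lemma proj_op_boundary:
  assumes inh: "increments_inherited S step_velocity \<xi> t" "t > 0" and S: "\<And>s. s \<ge> 0 \<Longrightarrow> \<xi> s \<in> S"
    and k: "{k, k'} = {k1, k2}" and k0: "gap k (\<xi> t) = 0"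
    and der: "\<And>j. j \<in> {k1, k2} \<Longrightarrow> gap j (\<xi> t) = 0 \<Longrightarrow> ((\<lambda>s. gap j (\<xi> s)) has_real_derivative 0) (at t)"
  shows "(\<xi> has_vector_derivative proj_op S E (\<xi> t) (F (\<xi> t))) (at t)"
proof -
  let ?y = "\<xi> t"
  let ?v = "F ?y"
  have kk: "k \<in> {k1, k2}" "k' \<in> {k1, k2}" using k by auto
  have kneq: "k \<noteq> k'" using k k_less by (auto simp: doubleton_eq_iff)
  have de: "((\<lambda>s. e (\<xi> s)) has_vector_derivative e ?v) (at t)"
    using e.tendsto[OF tendsto_F_one_step[of ?y]]
    by (intro vector_derivative_inherited[OF inh lin_e]) (simp add: case_prod_unfold)
  have dQ: "((\<lambda>s. free_part (\<xi> s)) has_vector_derivative free_part ?v) (at t)"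
    using bounded_linear.tendsto[OF bounded_linear_free_part tendsto_F_one_step[of ?y]]
    by (intro vector_derivative_inherited[OF inh bounded_linear_free_part]) (simp add: case_prod_unfold)
  have du: "((\<lambda>s. \<xi> s \<bullet> b) has_vector_derivative j * e ?v) (at t)"
    if "j \<in> {k1, k2}" "gap j ?y = 0" for j
  proof -
    have "((\<lambda>s. gap j (\<xi> s) + j * e (\<xi> s)) has_real_derivative 0 + j * e ?v) (at t)"
      using der[OF that] de unfolding has_real_derivative_iff_has_vector_derivative[symmetric]
      by (intro DERIV_add DERIV_cmult)
    then show ?thesis
      by (simp add: gap_def has_real_derivative_iff_has_vector_derivative)
  qed
  define w where "w = free_part ?v + (k * e ?v) *\<^sub>R b"
  have "((\<lambda>s. free_part (\<xi> s) + (\<xi> s \<bullet> b) *\<^sub>R b) has_vector_derivative w) (at t)"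
    unfolding w_def
    by (intro has_vector_derivative_add dQ bounded_linear.has_vector_derivative[OF bounded_linear_scaleR_left]
        du kk k0)
  then have dw: "(\<xi> has_vector_derivative w) (at t)" by (simp add: free_part_decomp[symmetric])
  have wT: "w \<in> tangent_cone S ?y"
    using S \<open>t > 0\<close> by (intro has_vector_derivative_in_tangent_cone[OF dw]) auto
  have Qv_b: "free_part ?v \<bullet> b = 0" by (simp add: free_part_def inner_diff_left)
  have Qw: "free_part w = free_part ?v" by (simp add: w_def free_part_def[of "_ + _"] inner_add_left Qv_b)
  have wb: "w \<bullet> b = k * e ?v" by (simp add: w_def inner_add_left Qv_b)
  have "proj_op S E ?y ?v = w"
  proof (rule proj_op_eq_boundary[OF wT Qw])
    fix w' assume w': "w' \<in> tangent_cone S ?y" "e w' = e ?v"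
      and le: "\<bar>w' \<bullet> b - ?v \<bullet> b\<bar> \<le> \<bar>w \<bullet> b - ?v \<bullet> b\<bar>"
    show "w' \<bullet> b = w \<bullet> b"
    proof (cases "gap k' ?y = 0")
      case True
      have "k * e ?v = k' * e ?v"
        using vector_derivative_unique_at[OF du[OF kk(1) k0] du[OF kk(2) True]] .
      then have e0: "e ?v = 0" using kneq by simp
      have "k * e ?y = k' * e ?y" using True k0 unfolding gap_def by linarith
      then have "(k - k') * e ?y = 0" by (simp add: algebra_simps)
      then have ey: "e ?y = 0" using kneq by simp
      then have yb: "?y \<bullet> b = 0" using k0 by (simp add: gap_def)
      have "w' \<in> S"
      proof (rule tangent_cone_subset_cone_at_apex[OF w'(1) closed_S])
        fix \<eta> and c :: real assume "\<eta> \<in> S" "c > 0"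
        moreover have "gap j (c *\<^sub>R (\<eta> - ?y)) = c * gap j \<eta>" for j
          by (simp add: gap_def e.scaleR e.diff ey yb inner_diff_left algebra_simps)
        ultimately show "c *\<^sub>R (\<eta> - ?y) \<in> S"
          by (simp add: S_iff mult_le_0_iff zero_le_mult_iff)
      qed
      then have "(w' \<bullet> b) * (w' \<bullet> b) \<le> 0" using w'(2) e0 by (simp add: S_iff gap_def)
      then have "w' \<bullet> b = 0" by (auto simp: mult_le_0_iff)
      then show ?thesis by (simp add: wb e0)
    next
      case False
      \<comment> \<open>Near \<open>\<xi> t\<close> the other gap keeps its sign \<open>\<sigma>\<close>, so the sector is locally \<open>\<sigma> * gap k \<le> 0\<close>.\<close>
      define \<sigma> where "\<sigma> = sgn (gap k' ?y)"
      have \<sigma>: "\<sigma> \<in> {-1, 1}" "\<sigma> * gap k' ?y > 0" using False by (auto simp: \<sigma>_def sgn_if)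
      have "\<sigma> * gap k w' \<le> 0"
      proof (rule tangent_cone_linear_le[OF w'(1)])
        show "bounded_linear (\<lambda>\<eta>. \<sigma> * gap k \<eta>)"
          by (intro bounded_linear_const_mult bounded_linear_gap)
        show "eventually (\<lambda>\<eta>. \<eta> \<in> S \<longrightarrow> \<sigma> * gap k \<eta> \<le> 0) (nhds ?y)"
          using eventually_gap_sign[OF \<sigma>(2)]
        proof eventually_elim
          case (elim \<eta>)
          show ?case
          proof
            assume "\<eta> \<in> S"
            then have "gap k \<eta> * gap k' \<eta> \<le> 0"
              using k by (auto simp: S_iff doubleton_eq_iff mult.commute)
            then show "\<sigma> * gap k \<eta> \<le> 0"
              using elim \<sigma>(1) by (auto simp: mult_le_0_iff)
          qed
        qed
      qed (simp add: k0)
      then have 1: "\<sigma> * (w' \<bullet> b) \<le> \<sigma> * (w \<bullet> b)" by (simp add: gap_def w'(2) wb algebra_simps)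
      have "\<sigma> * (w \<bullet> b) \<le> \<sigma> * (?v \<bullet> b) + \<epsilon>" if "\<epsilon> > 0" for \<epsilon>
      proof -
        have "w \<in> {v. (\<sigma> *\<^sub>R b) \<bullet> v \<le> \<sigma> * (?v \<bullet> b) + \<epsilon>}"
        proof (rule has_vector_derivative_inherited_in[OF inh closed_halfspace_le convex_halfspace_le _ dw])
          have "((\<lambda>p. \<sigma> * ((case p of (h, \<eta>) \<Rightarrow> F \<eta>) \<bullet> b)) \<longlongrightarrow> \<sigma> * (?v \<bullet> b)) (one_step_filter S ?y)"
            by (intro tendsto_intros tendsto_F_one_step)
          then have "eventually (\<lambda>p. \<sigma> * ((case p of (h, \<eta>) \<Rightarrow> F \<eta>) \<bullet> b) < \<sigma> * (?v \<bullet> b) + \<epsilon>) (one_step_filter S ?y)"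
            by (rule order_tendstoD) (use that in simp)
          with eventually_step_one_sided[OF kk(2) \<sigma>]
          show "eventually (\<lambda>(h, \<eta>). step_velocity h \<eta> \<in> {v. (\<sigma> *\<^sub>R b) \<bullet> v \<le> \<sigma> * (?v \<bullet> b) + \<epsilon>}) (one_step_filter S ?y)"
            by eventually_elim (auto simp: inner_commute)
        qed
        then show ?thesis by (simp add: inner_commute)
      qed
      then have 2: "\<sigma> * (w \<bullet> b) \<le> \<sigma> * (?v \<bullet> b)" by (rule field_le_epsilon)
      show ?thesis using 1 2 le \<sigma>(1) by auto
    qed
  qed
  with dw show ?thesis by simp
qed

text \<open>The limit of the clipped Euler scheme is the solution. Its gaps are Lipschitz functions of time, hence
  almost every time at which one of them vanishes is covered by the boundary lemma, and every other time
  by the interior lemma.\<close>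
theorem exists_caratheodory_solution:
  assumes growth: "\<And>\<eta>. \<eta> \<in> S \<Longrightarrow> norm (F \<eta>) \<le> M * (1 + norm \<eta>)" and "M \<ge> 0" and "\<xi>0 \<in> S"
  shows "\<exists>\<xi>. caratheodory_solution S E F \<xi> \<and> \<xi> 0 = \<xi>0"
proof -
  define C where "C = (2 + (\<bar>k1\<bar> + \<bar>k2\<bar>) * onorm e) * M"
  have c0: "2 + (\<bar>k1\<bar> + \<bar>k2\<bar>) * onorm e \<ge> 0" using onorm_pos_le[OF lin_e] by simp
  have "C \<ge> 0" using c0 \<open>M \<ge> 0\<close> by (simp add: C_def)
  moreover have "norm (step_velocity h \<eta>) \<le> C * (1 + norm \<eta>)" if "h > 0" "\<eta> \<in> S" for h \<eta>
    using norm_step_le[OF that] mult_left_mono[OF growth[OF that(2)] c0] by (simp add: C_def mult.assoc)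
  ultimately obtain \<xi> where \<xi>: "\<xi> 0 = \<xi>0" "\<And>t. t \<ge> 0 \<Longrightarrow> \<xi> t \<in> S"
    "\<And>T. T \<ge> 0 \<Longrightarrow> \<exists>L. L-lipschitz_on {0..T} \<xi>" "\<And>t. t \<ge> 0 \<Longrightarrow> increments_inherited S step_velocity \<xi> t"
    using one_step_scheme_limit[OF closed_S \<open>\<xi>0 \<in> S\<close>, of C step_velocity] step_in_S by metis
  have "caratheodory_solution_on S E F T \<xi>" if T: "T > 0" for T
    unfolding caratheodory_solution_on_def
  proof (intro conjI)
    obtain L where L: "L-lipschitz_on {0..T} \<xi>" using \<xi>(3)[of T] T by auto
    show "abs_continuous_on_Icc 0 T \<xi>" using L by (rule lipschitz_imp_abs_continuous)
    show "\<forall>t\<in>{0..T}. \<xi> t \<in> S" using \<xi>(2) by auto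
    have AE_k: "AE t in lebesgue. t \<in> {0<..<T} \<longrightarrow> gap k (\<xi> t) = 0 \<longrightarrow>
        ((\<lambda>s. gap k (\<xi> s)) has_real_derivative 0) (at t)" for k
    proof -
      obtain B where "B-lipschitz_on UNIV (gap k)"
        using bounded_linear.lipschitz_boundE[OF bounded_linear_gap] by blast
      then have "(B * L)-lipschitz_on {0..T} (\<lambda>s. gap k (\<xi> s))"
        by (intro lipschitz_on_compose2[OF L]) (rule lipschitz_on_subset[OF _ subset_UNIV])
      then have "(B * L)-lipschitz_on {0<..<T} (\<lambda>s. gap k (\<xi> s))"
        by (rule lipschitz_on_subset) auto
      then show ?thesis by (rule AE_has_derivative_zero_on_zero_set)
    qed
    have "AE t in lebesgue. t \<notin> {0, T}"
      by (intro AE_not_in) (simp add: negligible_iff_null_sets[symmetric])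
    with AE_k[of k1] AE_k[of k2]
    show "AE t\<in>{0..T} in lebesgue.
        (\<xi> has_vector_derivative proj_op S E (\<xi> t) (F (\<xi> t))) (at t within {0..T})"
    proof eventually_elim
      case (elim t)
      show ?case
      proof (intro impI, rule has_vector_derivative_at_within)
        assume "t \<in> {0..T}"
        then have t: "t \<in> {0<..<T}" "t > 0" using elim(3) by auto
        have inh: "increments_inherited S step_velocity \<xi> t" using \<xi>(4) t by simp
        have der: "((\<lambda>s. gap j (\<xi> s)) has_real_derivative 0) (at t)"
          if "j \<in> {k1, k2}" "gap j (\<xi> t) = 0" for j
          using that elim(1,2) t(1) by blast
        have "gap k1 (\<xi> t) * gap k2 (\<xi> t) \<le> 0" using \<xi>(2)[of t] t by (simp add: S_iff)
        then consider (interior) "gap k1 (\<xi> t) * gap k2 (\<xi> t) < 0"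
          | (boundary1) "gap k1 (\<xi> t) = 0" | (boundary2) "gap k2 (\<xi> t) = 0"
          by (metis mult_eq_0_iff order_le_less)
        then show "(\<xi> has_vector_derivative proj_op S E (\<xi> t) (F (\<xi> t))) (at t)"
        proof cases
          case interior
          show ?thesis by (rule proj_op_interior[OF inh t(2) _ interior]) (rule \<xi>(2))
        next
          case boundary1
          show ?thesis
            by (rule proj_op_boundary[OF inh t(2) _ refl boundary1 der]) (auto intro: \<xi>(2))
        next
          case boundary2
          show ?thesis
            by (rule proj_op_boundary[OF inh t(2) _ insert_commute boundary2 der]) (auto intro: \<xi>(2))
        qed
      qed
    qed
  qed
  then show ?thesis using \<xi>(1) unfolding caratheodory_solution_def by blast
qed

end

section \<open>The closed-loop system\<close>

theorem corollary9:
  fixes fp :: "(real ^ 'n::finite) \<times> real \<Rightarrow> real ^ 'n"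
    and fc :: "(real ^ 'm::{finite,linorder}) \<times> real \<Rightarrow> real ^ 'm::{finite,linorder}"
    and G :: "real ^ 'n ^ 1"
    and k1 k2 :: real
    and \<xi>0 :: "(real ^ 'n) \<times> (real ^ 'm::{finite,linorder})"
  assumes "continuous_on UNIV fp"
    and "continuous_on UNIV fc"
    and "k1 < k2"
    and "\<exists>M>0. \<forall>\<xi> \<in> constraint_set G k1 k2.
           norm (closed_loop fp fc G \<xi>) \<le> M * (1 + norm \<xi>)"
    and "\<xi>0 \<in> constraint_set G k1 k2"
  shows "\<exists>\<xi> :: real \<Rightarrow> (real ^ 'n) \<times> (real ^ 'm::{finite,linorder}).
           caratheodory_solution (constraint_set G k1 k2) correction_subspace
             (closed_loop fp fc G) \<xi> \<and> \<xi> 0 = \<xi>0"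
proof -
  let ?e = "\<lambda>\<xi>::(real ^ 'n) \<times> (real ^ 'm::{finite,linorder}). plant_output G (fst \<xi>)"
  let ?b = "(0, axis (Min UNIV) 1) :: (real ^ 'n) \<times> (real ^ 'm::{finite,linorder})"
  let ?F = "closed_loop fp fc G"
  have lin: "bounded_linear (plant_output G)"
    unfolding plant_output_def
    by (intro bounded_linear_compose[OF bounded_linear_vec_nth] matrix_vector_mul_bounded_linear)
  have cont: "continuous_on UNIV ?F"
  proof -
    have "continuous_on UNIV (\<lambda>\<xi>::(real ^ 'n) \<times> (real ^ 'm::{finite,linorder}). (fst \<xi>, snd \<xi> $ Min UNIV))"
      by (intro continuous_intros)
    moreover have "continuous_on UNIV (\<lambda>\<xi>::(real ^ 'n) \<times> (real ^ 'm::{finite,linorder}). (snd \<xi>, plant_output G (fst \<xi>)))"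
      by (intro continuous_intros bounded_linear.continuous_on[OF lin])
    ultimately show ?thesis
      unfolding closed_loop_def case_prod_unfold first_component_def
      using assms(1,2) by (intro continuous_on_Pair) (auto intro: continuous_on_compose2)
  qed
  interpret projected_sector_system ?e ?b k1 k2 ?F correction_subspace
  proof (rule projected_sector_system.intro)
    show "bounded_linear ?e" by (rule bounded_linear_compose[OF lin bounded_linear_fst])
    show "norm ?b = 1" by (simp add: norm_Pair)
    show "?e d = 0" if "d \<in> correction_subspace" for d
      using that linear_0[OF bounded_linear.linear[OF lin]] by (auto simp: correction_subspace_def)
  qed (auto simp: correction_subspace_def assms cont)
  have S_eq: "S = constraint_set G k1 k2"
    by (auto simp: S_def constraint_set_def first_component_def inner_axis)
  obtain M where "M > 0" "\<And>\<eta>. \<eta> \<in> S \<Longrightarrow> norm (?F \<eta>) \<le> M * (1 + norm \<eta>)"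
    using assms(4) unfolding S_eq by auto
  then show ?thesis
    using exists_caratheodory_solution[of M \<xi>0] assms(5) unfolding S_eq by simp
qed

end
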